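(* Let $A=(a_n)_{n\in\mathbb{N}}$ and $B=(b_n)_{n\in\mathbb{N}}$ be two Waterman sequences and assume that $B$ is proper. The following statements are equivalent: (a) if $K\subseteq \mathrm{ABV}$ is bounded in $\mathrm{ABV}$ and relatively compact in the supremum norm $\|\cdot\|_\infty$, then $K\subseteq \mathrm{BBV}$ and $K$ is relatively compact in the space $\mathrm{BBV}$; (b) $\mathcal{I}_A\leq_K\mathcal{I}_{B^M}$ for some increasing sequence $M=(m_k)_{k\in\mathbb{N}}$ of natural numbers; (c) $\sum_{k=1}^n b_k = o\left(\sum_{k=1}^n a_k\right)$, i.e. $\lim_{n\to +\infty} \frac{\sum_{k=1}^n b_k}{\sum_{k=1}^n a_k}=0$.
   Context: $\mathbb{N}=\{1,2,\ldots\}$ and $I=[0,1]$. A Waterman sequence is a nonincreasing sequence $A=(a_n)_{n\in\mathbb{N}}$ of positive reals with $\sum_{n=1}^\infty a_n=+\infty$; it is proper if additionally $\lim_{n\to\infty} a_n=0$. Let $\mathcal{P}_I$ be the set of all infinite sequences $(I_n)_{n\in\mathbb{N}}$ of nonoverlapping closed subintervals of $I$ (degenerate one-point intervals are allowed). For $x\colon I\to\mathbb{R}$ and $I_n=[s_n,t_n]$ put $|x(I_n)|=|x(t_n)-x(s_n)|$. The $A$-variation of $x$ is $\mathrm{var}_A(x)=\sup\sum_{n=1}^{\infty}a_n|x(I_n)|$, the supremum taken over all $(I_n)\in\mathcal{P}_I$. The Waterman space $\mathrm{ABV}$ is the Banach space of all $x\colon I\to\mathbb{R}$ with $\mathrm{var}_A(x)<\infty$,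 with norm $\|x\|_{\mathrm{ABV}}=|x(0)|+\mathrm{var}_A(x)$; $\mathrm{BBV}$ is the analogous space for the sequence $B$. All functions in these spaces are bounded, and $\|x\|_\infty=\sup_{t\in I}|x(t)|$; relatively compact in the supremum norm means relatively compact in the Banach space of all bounded functions $I\to\mathbb{R}$ with $\|\cdot\|_\infty$. For a sequence $A=(a_n)$ of positive reals, $\mathcal{I}_A=\{C\subseteq\mathbb{N}:\sum_{n\in C}a_n<\infty\}$. For $\mathcal{I},\mathcal{J}\subseteq\mathcal{P}(\mathbb{N})$ ideals on $\mathbb{N}$ (or $\mathcal{I}$ an ideal and $\mathcal{J}=\mathcal{P}(\mathbb{N})$), $\mathcal{I}\leq_K\mathcal{J}$ (Katětov order) means that there is a function $f\colon\mathbb{N}\to\mathbb{N}$ such that $f^{-1}[C]\in\mathcal{J}$ for every $C\in\mathcal{I}$. For a sequence $B=(b_n)$ of positive reals and an increasing sequence $M=(m_k)_{k\in\mathbb{N}}$ of natural numbers, $B^M=(b^M_n)_{n\in\mathbb{N}}$ is defined by $b^M_n=k\,b_n$, where $k$ is given by $m_k\leq n<m_{k+1}$, and $b_n^M=b_n$ for $n<m_1$. *)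

theory Defs
  imports "HOL-Analysis.Analysis"
begin

text \<open>
  Sequences \<open>(a\<^sub>n)\<close> indexed by \<open>{1, 2, ...}\<close> are functions \<^typ>\<open>nat \<Rightarrow> real\<close> whose value
  at \<open>0\<close> is irrelevant.  Functions \<open>[0,1] \<rightarrow> \<real>\<close> are members of \<^term>\<open>extensional {0..1::real}\<close>.
\<close>

definition waterman :: "(nat \<Rightarrow> real) \<Rightarrow> bool" where
  "waterman a \<longleftrightarrow> (\<forall>n\<ge>1. a n > 0) \<and> antimono_on {1..} a \<and> \<not> summable (\<lambda>n. a (Suc n))"

definition proper_waterman :: "(nat \<Rightarrow> real) \<Rightarrow> bool" where
  "proper_waterman a \<longleftrightarrow> waterman a \<and> a \<longlonglongrightarrow> 0"

text \<open>The \<open>n\<close>-th interval is \<open>[s n, t n]\<close> for \<open>n \<ge> 1\<close>; nonoverlapping means disjoint interiors.\<close>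

definition interval_seqs :: "((nat \<Rightarrow> real) \<times> (nat \<Rightarrow> real)) set" where
  "interval_seqs = {(s, t). (\<forall>n\<ge>1. 0 \<le> s n \<and> s n \<le> t n \<and> t n \<le> 1) \<and>
                            disjoint_family_on (\<lambda>n. {s n<..<t n}) {1..}}"

definition wvar :: "(nat \<Rightarrow> real) \<Rightarrow> (real \<Rightarrow> real) \<Rightarrow> ennreal" where
  "wvar a x = (SUP (s, t)\<in>interval_seqs.
                 \<Sum>n. ennreal (a (Suc n) * \<bar>x (t (Suc n)) - x (s (Suc n))\<bar>))"

definition wspace :: "(nat \<Rightarrow> real) \<Rightarrow> (real \<Rightarrow> real) set" where
  "wspace a = {x \<in> extensional {0..1}. wvar a x < \<infinity>}"

definition wnorm :: "(nat \<Rightarrow> real) \<Rightarrow> (real \<Rightarrow> real) \<Rightarrow> real" where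
  "wnorm a x = \<bar>x 0\<bar> + enn2real (wvar a x)"

definition bfun_space :: "(real \<Rightarrow> real) set" where
  "bfun_space = {x \<in> extensional {0..1}. bounded (x ` {0..1})}"

text \<open>
  The supremum is taken in \<^typ>\<open>ennreal\<close> because \<^const>\<open>Metric_space\<close> asks for nonnegativity
  off the carrier too, while real suprema of unbounded sets are unspecified.  On bounded functions
  this is the real supremum, see \<open>sup_norm_eq_SUP\<close> below.
\<close>

definition sup_norm :: "(real \<Rightarrow> real) \<Rightarrow> real" where
  "sup_norm x = enn2real (SUP t\<in>{0..1}. ennreal \<bar>x t\<bar>)"

text \<open>
  The topology of the space \<open>X\<close> with norm \<open>N\<close>.  The pointwise difference \<^term>\<open>x - y\<close> need not
  be extensional, but both norms above only depend on the values on \<open>[0,1]\<close>.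
\<close>

definition norm_topology ::
    "(real \<Rightarrow> real) set \<Rightarrow> ((real \<Rightarrow> real) \<Rightarrow> real) \<Rightarrow> (real \<Rightarrow> real) topology" where
  "norm_topology X N = Metric_space.mtopology X (\<lambda>x y. N (x - y))"

definition relatively_compact_in :: "'a topology \<Rightarrow> 'a set \<Rightarrow> bool" where
  "relatively_compact_in T K \<longleftrightarrow> K \<subseteq> topspace T \<and> compactin T (T closure_of K)"

definition summable_ideal :: "(nat \<Rightarrow> real) \<Rightarrow> nat set set" where
  "summable_ideal a = {C. C \<subseteq> {1..} \<and> a summable_on C}"

definition katetov_le :: "nat set set \<Rightarrow> nat set set \<Rightarrow> bool" where
  "katetov_le \<I> \<J> \<longleftrightarrow> (\<exists>f \<in> {1..} \<rightarrow> {1..}. \<forall>C\<in>\<I>. f -` C \<inter> {1..} \<in> \<J>)"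

definition index_seq :: "(nat \<Rightarrow> nat) \<Rightarrow> bool" where
  "index_seq m \<longleftrightarrow> (\<forall>k\<ge>1. m k \<ge> 1) \<and> strict_mono_on {1..} m"

definition block_scale :: "(nat \<Rightarrow> nat) \<Rightarrow> (nat \<Rightarrow> real) \<Rightarrow> nat \<Rightarrow> real" where
  "block_scale m b n =
     (if n < m 1 then b n else real (THE k. k \<ge> 1 \<and> m k \<le> n \<and> n < m (Suc k)) * b n)"

lemma block_scale_eq:
  assumes "index_seq m" "k \<ge> 1" "m k \<le> n" "n < m (Suc k)"
  shows "block_scale m b n = real k * b n"
proof -
  have mono: "m i \<le> m j" if "1 \<le> i" "i \<le> j" for i j
    using assms(1) that strict_mono_on_leD[of "{1..}" m i j] by (simp add: index_seq_def)
  have "(THE k. k \<ge> 1 \<and> m k \<le> n \<and> n < m (Suc k)) = k"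
  proof (rule the_equality)
    fix j assume j: "j \<ge> 1 \<and> m j \<le> n \<and> n < m (Suc j)"
    show "j = k"
    proof (rule linorder_cases[of j k])
      assume "j < k"
      then show ?thesis using mono[of "Suc j" k] j assms by simp
    next
      assume "k < j"
      then show ?thesis using mono[of "Suc k" j] j assms by simp
    qed
  qed (use assms in auto)
  moreover have "\<not> n < m 1"
    using mono[of 1 k] assms by simp
  ultimately show ?thesis by (simp add: block_scale_def)
qed

lemma block_exists:
  assumes "index_seq m" "m 1 \<le> n"
  shows "\<exists>k\<ge>1. m k \<le> n \<and> n < m (Suc k)"
proof -
  have ge: "k \<le> m k" if "k \<ge> 1" for k
    using that
  proof (induction k rule: dec_induct)
    case base
    then show ?case using assms(1) by (simp add: index_seq_def)
  next
    case (step k)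
    have "m k < m (Suc k)"
      using assms(1) step(1) by (auto simp: index_seq_def intro: strict_mono_onD)
    then show ?case using step by simp
  qed
  define S where "S = {k. 1 \<le> k \<and> m k \<le> n}"
  have "S \<subseteq> {..n}" using ge by (force simp: S_def)
  then have fin: "finite S" using finite_subset by blast
  have "1 \<in> S" using assms by (simp add: S_def)
  then have "Max S \<in> S" using fin Max_in by blast
  moreover have "Suc (Max S) \<notin> S" using fin Max_ge Suc_n_not_le_n by blast
  ultimately show ?thesis by (intro exI[of _ "Max S"]) (auto simp: S_def)
qed

lemma wvar_triangle:
  assumes "waterman a"
  shows "wvar a (x - z) \<le> wvar a (x - y) + wvar a (y - z)"
  unfolding wvar_def[of a "x - z"]
proof (rule SUP_least, clarify)
  fix s t assume st: "(s, t) \<in> interval_seqs"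
  define V where "V = (\<lambda>u n. ennreal (a (Suc n) * \<bar>u (t (Suc n)) - u (s (Suc n))\<bar>))"
  have pos: "a (Suc n) \<ge> 0" for n
    using assms by (simp add: waterman_def less_imp_le)
  have "V (x - z) n \<le> V (x - y) n + V (y - z) n" for n
  proof -
    have "a (Suc n) * \<bar>(x - z) (t (Suc n)) - (x - z) (s (Suc n))\<bar>
      \<le> a (Suc n) * (\<bar>(x - y) (t (Suc n)) - (x - y) (s (Suc n))\<bar>
                      + \<bar>(y - z) (t (Suc n)) - (y - z) (s (Suc n))\<bar>)"
      by (rule mult_left_mono[OF _ pos]) simp
    then have "V (x - z) n \<le> ennreal (a (Suc n) * (\<bar>(x - y) (t (Suc n)) - (x - y) (s (Suc n))\<bar>
                      + \<bar>(y - z) (t (Suc n)) - (y - z) (s (Suc n))\<bar>))"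
      unfolding V_def by (rule ennreal_leI)
    also have "\<dots> = V (x - y) n + V (y - z) n"
      unfolding V_def distrib_left by (rule ennreal_plus) (simp_all add: pos)
    finally show ?thesis .
  qed
  then have "(\<Sum>n. V (x - z) n) \<le> (\<Sum>n. V (x - y) n + V (y - z) n)"
    by (intro suminf_le) auto
  also have "\<dots> = (\<Sum>n. V (x - y) n) + (\<Sum>n. V (y - z) n)"
    by (simp add: suminf_add[symmetric])
  also have "\<dots> \<le> wvar a (x - y) + wvar a (y - z)"
    unfolding wvar_def V_def using st
    by (intro add_mono SUP_upper2[of "(s, t)"]) auto
  finally show "(\<Sum>n. ennreal (a (Suc n) * \<bar>(x - z) (t (Suc n)) - (x - z) (s (Suc n))\<bar>))
      \<le> wvar a (x - y) + wvar a (y - z)"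
    by (simp add: V_def)
qed

lemma wvar_minus_commute: "wvar a (x - y) = wvar a (y - x)"
proof -
  have "\<bar>(x - y) p - (x - y) q\<bar> = \<bar>(y - x) p - (y - x) q\<bar>" for p q
    by simp
  then show ?thesis unfolding wvar_def by (simp only:)
qed

lemma wvar_zero: "wvar a (\<lambda>_. 0) = 0"
  by (auto simp: wvar_def intro!: antisym SUP_least)

lemma wvar_minus_finite:
  assumes "waterman a" "x \<in> wspace a" "y \<in> wspace a"
  shows "wvar a (x - y) < \<infinity>"
proof -
  have "wvar a (x - y) \<le> wvar a (x - (\<lambda>_. 0)) + wvar a ((\<lambda>_. 0) - y)"
    by (rule wvar_triangle[OF assms(1)])
  also have "\<dots> = wvar a x + wvar a y"
    by (subst wvar_minus_commute[of a "\<lambda>_. 0" y]) (simp add: fun_diff_def)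
  also have "\<dots> < \<infinity>"
    using assms(2,3) by (simp add: wspace_def)
  finally show ?thesis .
qed

lemma wvar_ge:
  assumes "t \<in> {0..1}"
  shows "ennreal (a 1 * \<bar>x t - x 0\<bar>) \<le> wvar a x"
proof -
  define s' where "s' = (\<lambda>n::nat. 0::real)"
  define t' where "t' = (\<lambda>n::nat. if n = 1 then t else 0)"
  have "(s', t') \<in> interval_seqs"
    using assms by (auto simp: interval_seqs_def s'_def t'_def disjoint_family_on_def)
  then have "(\<Sum>n. ennreal (a (Suc n) * \<bar>x (t' (Suc n)) - x (s' (Suc n))\<bar>)) \<le> wvar a x"
    unfolding wvar_def by (intro SUP_upper2[of "(s', t')"]) auto
  moreover have "(\<Sum>n. ennreal (a (Suc n) * \<bar>x (t' (Suc n)) - x (s' (Suc n))\<bar>))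
      = (\<Sum>n\<in>{0}. ennreal (a (Suc n) * \<bar>x (t' (Suc n)) - x (s' (Suc n))\<bar>))"
    by (rule suminf_finite) (auto simp: s'_def t'_def)
  ultimately show ?thesis by (simp add: s'_def t'_def)
qed

lemma Metric_space_wspace:
  assumes "waterman a"
  shows "Metric_space (wspace a) (\<lambda>x y. wnorm a (x - y))"
proof
  show "0 \<le> wnorm a (x - y)" for x y
    by (simp add: wnorm_def)
  show "wnorm a (x - y) = wnorm a (y - x)" for x y
    by (simp add: wnorm_def wvar_minus_commute[of a x y] abs_minus_commute)
  show "wnorm a (x - y) = 0 \<longleftrightarrow> x = y" if x: "x \<in> wspace a" and y: "y \<in> wspace a" for x y
  proof
    assume "wnorm a (x - y) = 0"
    then have 0: "x 0 = y 0" and "enn2real (wvar a (x - y)) = 0"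
      by (auto simp: wnorm_def add_nonneg_eq_0_iff)
    then have v: "wvar a (x - y) = 0"
      using wvar_minus_finite[OF assms x y] by (auto simp: enn2real_eq_0_iff)
    have "x t = y t" if "t \<in> {0..1}" for t
    proof -
      have "ennreal (a 1 * \<bar>(x - y) t - (x - y) 0\<bar>) = 0"
        using wvar_ge[OF that, of a "x - y"] v by simp
      then have "a 1 * \<bar>x t - y t\<bar> \<le> 0"
        using 0 by (simp add: ennreal_eq_0_iff)
      moreover have "a 1 > 0" using assms by (simp add: waterman_def)
      ultimately show ?thesis by (simp add: mult_le_0_iff)
    qed
    then show "x = y"
      using x y by (intro extensionalityI[of _ "{0..1}"]) (auto simp: wspace_def)
  next
    assume "x = y"
    then show "wnorm a (x - y) = 0" by (simp add: wnorm_def wvar_zero fun_diff_def)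
  qed
  show "wnorm a (x - z) \<le> wnorm a (x - y) + wnorm a (y - z)"
    if "x \<in> wspace a" "y \<in> wspace a" "z \<in> wspace a" for x y z
  proof -
    have fin: "wvar a (x - y) < \<infinity>" "wvar a (y - z) < \<infinity>"
      using wvar_minus_finite[OF assms] that by auto
    have "enn2real (wvar a (x - z)) \<le> enn2real (wvar a (x - y) + wvar a (y - z))"
      using wvar_triangle[OF assms, of x z y] fin by (intro enn2real_mono) auto
    also have "\<dots> = enn2real (wvar a (x - y)) + enn2real (wvar a (y - z))"
      using fin by (intro enn2real_plus) auto
    finally show ?thesis by (simp add: wnorm_def)
  qed
qed

lemma sup_norm_eq_SUP:
  assumes "bounded (x ` {0..1})"
  shows "sup_norm x = (SUP t\<in>{0..1}. \<bar>x t\<bar>)"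
proof -
  have bdd: "bdd_above ((\<lambda>t. \<bar>x t\<bar>) ` {0..1})"
    using assms by (auto simp: bounded_iff intro: bdd_aboveI2)
  have "0 \<le> \<bar>x 0\<bar>" by simp
  also have "\<dots> \<le> (SUP t\<in>{0..1}. \<bar>x t\<bar>)"
    by (rule cSUP_upper[OF _ bdd]) simp
  finally have nn: "0 \<le> (SUP t\<in>{0..1}. \<bar>x t\<bar>)" .
  have "(SUP t\<in>{0..1}. ennreal \<bar>x t\<bar>) = ennreal (SUP t\<in>{0..1}. \<bar>x t\<bar>)"
  proof (rule antisym)
    show "(SUP t\<in>{0..1}. ennreal \<bar>x t\<bar>) \<le> ennreal (SUP t\<in>{0..1}. \<bar>x t\<bar>)"
      by (intro SUP_least ennreal_leI cSUP_upper[OF _ bdd])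
    have fin: "(SUP t\<in>{0..1}. ennreal \<bar>x t\<bar>) < \<infinity>"
      using \<open>(SUP t\<in>{0..1}. ennreal \<bar>x t\<bar>) \<le> ennreal (SUP t\<in>{0..1}. \<bar>x t\<bar>)\<close>
      by (simp add: le_less_trans)
    have "\<bar>x t\<bar> \<le> enn2real (SUP t\<in>{0..1}. ennreal \<bar>x t\<bar>)" if "t \<in> {0..1}" for t
    proof -
      have "enn2real (ennreal \<bar>x t\<bar>) \<le> enn2real (SUP t\<in>{0..1}. ennreal \<bar>x t\<bar>)"
        using fin that by (intro enn2real_mono SUP_upper) auto
      then show ?thesis by simp
    qed
    then have "(SUP t\<in>{0..1}. \<bar>x t\<bar>) \<le> enn2real (SUP t\<in>{0..1}. ennreal \<bar>x t\<bar>)"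
      by (intro cSUP_least) auto
    then have "ennreal (SUP t\<in>{0..1}. \<bar>x t\<bar>) \<le> ennreal (enn2real (SUP t\<in>{0..1}. ennreal \<bar>x t\<bar>))"
      by (rule ennreal_leI)
    also have "\<dots> = (SUP t\<in>{0..1}. ennreal \<bar>x t\<bar>)"
      by (rule ennreal_enn2real) (use fin in simp)
    finally show "ennreal (SUP t\<in>{0..1}. \<bar>x t\<bar>) \<le> (SUP t\<in>{0..1}. ennreal \<bar>x t\<bar>)" .
  qed
  then show ?thesis using nn by (simp add: sup_norm_def)
qed

lemma bfun_bounded_diff:
  assumes "x \<in> bfun_space" "y \<in> bfun_space"
  shows "bounded ((x - y) ` {0..1})"
proof -
  have "\<exists>c. \<forall>t\<in>{0..1}. \<bar>u t\<bar> \<le> c" if "u \<in> bfun_space" for u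
    using that by (simp add: bfun_space_def bounded_iff)
  then obtain c d where cd: "\<And>t. t \<in> {0..1} \<Longrightarrow> \<bar>x t\<bar> \<le> c" "\<And>t. t \<in> {0..1} \<Longrightarrow> \<bar>y t\<bar> \<le> d"
    using assms by meson
  have "\<bar>x t - y t\<bar> \<le> c + d" if "t \<in> {0..1}" for t
    using cd[OF that] by linarith
  then show ?thesis unfolding bounded_iff by (intro exI[of _ "c + d"]) auto
qed

lemma sup_norm_ge:
  assumes "x \<in> bfun_space" "y \<in> bfun_space" "t \<in> {0..1}"
  shows "\<bar>x t - y t\<bar> \<le> sup_norm (x - y)"
proof -
  have "bdd_above ((\<lambda>t. \<bar>(x - y) t\<bar>) ` {0..1})"
    using bfun_bounded_diff[OF assms(1,2)] by (auto simp: bounded_iff intro: bdd_aboveI2)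
  then have "\<bar>(x - y) t\<bar> \<le> (SUP t\<in>{0..1}. \<bar>(x - y) t\<bar>)"
    by (rule cSUP_upper[OF assms(3)])
  then show ?thesis using sup_norm_eq_SUP[OF bfun_bounded_diff[OF assms(1,2)]] by simp
qed

lemma Metric_space_bfun_space: "Metric_space bfun_space (\<lambda>x y. sup_norm (x - y))"
proof
  show "0 \<le> sup_norm (x - y)" for x y
    by (simp add: sup_norm_def)
  show "sup_norm (x - y) = sup_norm (y - x)" for x y
    by (simp add: sup_norm_def abs_minus_commute)
  show "sup_norm (x - y) = 0 \<longleftrightarrow> x = y" if x: "x \<in> bfun_space" and y: "y \<in> bfun_space" for x y
  proof
    assume 0: "sup_norm (x - y) = 0"
    have "x t = y t" if "t \<in> {0..1}" for t
      using sup_norm_ge[OF x y that] 0 by simp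
    then show "x = y"
      using x y by (intro extensionalityI[of _ "{0..1}"]) (auto simp: bfun_space_def)
  qed (simp add: sup_norm_def)
  show "sup_norm (x - z) \<le> sup_norm (x - y) + sup_norm (y - z)"
    if x: "x \<in> bfun_space" and y: "y \<in> bfun_space" and z: "z \<in> bfun_space" for x y z
  proof -
    have "\<bar>(x - z) t\<bar> \<le> sup_norm (x - y) + sup_norm (y - z)" if "t \<in> {0..1}" for t
      using sup_norm_ge[OF x y that] sup_norm_ge[OF y z that] by simp
    then show ?thesis
      unfolding sup_norm_eq_SUP[OF bfun_bounded_diff[OF x z]] by (intro cSUP_least) auto
  qed
qed

lemma wspace_subset_bfun_space:
  assumes "waterman a"
  shows "wspace a \<subseteq> bfun_space"
proof
  fix x assume x: "x \<in> wspace a"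
  have a1: "a 1 > 0" using assms by (simp add: waterman_def)
  have fin: "wvar a x < \<infinity>" using x by (simp add: wspace_def)
  have "\<bar>x t\<bar> \<le> \<bar>x 0\<bar> + enn2real (wvar a x) / a 1" if "t \<in> {0..1}" for t
  proof -
    have "enn2real (ennreal (a 1 * \<bar>x t - x 0\<bar>)) \<le> enn2real (wvar a x)"
      using wvar_ge[OF that] fin by (intro enn2real_mono) auto
    then have "a 1 * \<bar>x t - x 0\<bar> \<le> enn2real (wvar a x)"
      using a1 by simp
    then have "\<bar>x t - x 0\<bar> \<le> enn2real (wvar a x) / a 1"
      using a1 by (simp add: field_simps)
    then show ?thesis by linarith
  qed
  then have "bounded (x ` {0..1})"
    unfolding bounded_iff by (intro exI[of _ "\<bar>x 0\<bar> + enn2real (wvar a x) / a 1"]) auto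
  then show "x \<in> bfun_space" using x by (simp add: wspace_def bfun_space_def)
qed

end

theory Submission
  imports Defs
begin

text \<open>
  Write \<open>A\<^sub>n\<close> and \<open>B\<^sub>n\<close> for the partial sums of \<open>a\<close> and \<open>b\<close>. The ratio \<open>B\<^sub>n / A\<^sub>n\<close> tends to \<open>0\<close> iff for every
  \<open>e > 0\<close> there is \<open>\<beta>\<close> with \<open>B\<^sub>n \<le> \<beta> + e A\<^sub>n\<close> for all \<open>n\<close>. Arranging the increments of \<open>x\<close> in decreasing
  order and summing by parts turns this into
  \<open>var\<^sub>B(x) \<le> 2 \<beta> \<parallel>x\<parallel>\<^sub>\<infinity> + e var\<^sub>A(x)\<close>,
  so on bounded subsets of \<open>ABV\<close> uniform convergence implies convergence in \<open>BBV\<close>. Conversely, if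
  \<open>B\<^sub>n / A\<^sub>n \<ge> \<epsilon>\<close> infinitely often, the functions with \<open>n\<close> spikes of height \<open>1 / A\<^sub>n\<close> for these \<open>n\<close> are
  bounded in \<open>ABV\<close> and tend uniformly to \<open>0\<close>, but their \<open>B\<close>-variation stays above \<open>\<epsilon>\<close>.

  If \<open>M\<close> is sparse enough, the partial sums of \<open>B\<^sup>M\<close> are still small compared with \<open>A\<^sub>n\<close>, and a greedy packing
  yields a reduction whose fibre over \<open>j\<close> has weight at most \<open>2 a\<^sub>j\<close>. Given a reduction \<open>f\<close> and \<open>a \<longlonglongrightarrow> 0\<close>, a
  gliding hump argument shows that the fibres over a set \<open>F\<close> have total weight at most
  \<open>D + L \<Sum>\<^sub>F a\<close>. As \<open>f\<close> maps \<open>{1..n}\<close> to at most \<open>n\<close> indices and \<open>a\<close> decreases, the partial sums of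
  \<open>B\<^sup>M\<close> are at most \<open>D + L A\<^sub>n\<close>, and the unbounded factors in \<open>B\<^sup>M\<close> give \<open>B\<^sub>n = o(A\<^sub>n)\<close>. If \<open>a\<close> does not tend to
  \<open>0\<close>, then \<open>A\<^sub>n\<close> grows linearly, and \<open>b \<longlonglongrightarrow> 0\<close> suffices.
\<close>

section \<open>Weighted variation and decreasing rearrangement\<close>

text \<open>Induction removing the largest element \<open>M\<close>: as \<open>M\<close> is at least
  \<open>card S\<close>, the value \<open>b M\<close> is at most the last term of the initial
  sum.\<close>

lemma sum_antimono_le_initial:
  fixes b :: "nat \<Rightarrow> real"
  assumes b: "antimono_on {1..} b" and "finite S" "S \<subseteq> {1..}"
  shows "sum b S \<le> sum b {1..card S}"
  using assms(2,3)
proof (induction "card S" arbitrary: S)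
  case 0
  then show ?case by simp
next
  case (Suc n)
  define M where "M = Max S"
  have "S \<noteq> {}" using Suc.hyps(2) by auto
  then have M: "M \<in> S" using Suc.prems by (simp add: M_def)
  have "S \<subseteq> {1..M}" using Suc.prems by (auto simp: M_def)
  then have "card S \<le> M" using card_mono[of "{1..M}" S] by simp
  then have bM: "b M \<le> b (card S)"
    using Suc.hyps(2) M Suc.prems by (intro monotone_onD[OF b]) auto
  have "sum b (S - {M}) \<le> sum b {1..card (S - {M})}"
    using Suc M by (intro Suc.hyps(1)) auto
  moreover have "card (S - {M}) = n" using M Suc by simp
  moreover have "sum b S = b M + sum b (S - {M})"
    using M Suc.prems by (simp add: sum.remove)
  ultimately show ?case using bM by (simp flip: Suc.hyps(2))
qed

text \<open>Abel summation in inductive form: the differences \<open>D k\<close> of partial sums are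
  nonnegative, so lowering the weight from \<open>w k\<close> to \<open>w (Suc k)\<close> in
  \<open>w k * D k\<close> only weakens the lower bound in \<open>main\<close>.\<close>

lemma sum_mult_antimono_mono:
  fixes p q w :: "nat \<Rightarrow> real"
  assumes pq: "\<And>k. k \<le> m \<Longrightarrow> sum p {1..k} \<le> sum q {1..k}"
    and w: "\<And>i j. 1 \<le> i \<Longrightarrow> i \<le> j \<Longrightarrow> j \<le> m \<Longrightarrow> w j \<le> w i"
    and nonneg: "\<And>i. 1 \<le> i \<Longrightarrow> i \<le> m \<Longrightarrow> 0 \<le> w i"
  shows "(\<Sum>i=1..m. p i * w i) \<le> (\<Sum>i=1..m. q i * w i)"
proof -
  define D where "D = (\<lambda>k. \<Sum>i=1..k. q i - p i)"
  have D: "0 \<le> D k" if "k \<le> m" for k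
    using pq[OF that] by (simp add: D_def sum_subtractf)
  have main: "w k * D k \<le> (\<Sum>i=1..k. (q i - p i) * w i)" if "1 \<le> k" "k \<le> m" for k
    using that
  proof (induction k rule: dec_induct)
    case base
    then show ?case by (simp add: D_def)
  next
    case (step k)
    have "w (Suc k) * D (Suc k) = w (Suc k) * D k + (q (Suc k) - p (Suc k)) * w (Suc k)"
      by (simp add: D_def algebra_simps)
    moreover have "w (Suc k) * D k \<le> w k * D k"
      using w[of k "Suc k"] D[of k] step by (intro mult_right_mono) auto
    ultimately show ?case using step by simp
  qed
  show ?thesis
  proof (cases "m = 0")
    case False
    then have "0 \<le> w m * D m" using D[of m] nonneg[of m] by simp
    also have "\<dots> \<le> (\<Sum>i=1..m. (q i - p i) * w i)" using main False by simp
    finally show ?thesis by (simp add: left_diff_distrib sum_subtractf)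
  qed simp
qed

text \<open>A minimiser of \<open>v\<close> takes the last place; induction orders the rest.\<close>

lemma ex_antimono_enumeration:
  fixes v :: "nat \<Rightarrow> real"
  assumes "finite S"
  shows "\<exists>p. bij_betw p {1..card S} S \<and>
             (\<forall>i j. 1 \<le> i \<and> i \<le> j \<and> j \<le> card S \<longrightarrow> v (p j) \<le> v (p i))"
  using assms
proof (induction "card S" arbitrary: S)
  case 0
  then show ?case by (simp add: bij_betw_def)
next
  case (Suc n)
  have ne: "S \<noteq> {}" using Suc.hyps(2) by auto
  define x where "x = arg_min_on v S"
  have x: "x \<in> S" "\<And>y. y \<in> S \<Longrightarrow> v x \<le> v y"
    using arg_min_if_finite(1)[OF Suc.prems ne] arg_min_least[OF Suc.prems ne] by (auto simp: x_def)
  have n: "n = card (S - {x})" using x Suc by simp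
  obtain p where p: "bij_betw p {1..n} (S - {x})"
    and mono: "\<And>i j. 1 \<le> i \<Longrightarrow> i \<le> j \<Longrightarrow> j \<le> n \<Longrightarrow> v (p j) \<le> v (p i)"
    using Suc.hyps(1)[OF n] Suc.prems n by (metis finite_Diff)
  define p' where "p' = p(Suc n := x)"
  have "bij_betw p' {1..n} (S - {x})"
    using p by (rule bij_betw_cong[THEN iffD1, rotated]) (simp add: p'_def)
  then have "bij_betw p' ({1..n} \<union> {Suc n}) ((S - {x}) \<union> {x})"
    by (intro bij_betw_combine) (auto simp: p'_def bij_betw_def)
  moreover have "{1..n} \<union> {Suc n} = {1..card S}" "(S - {x}) \<union> {x} = S"
    using x Suc.hyps(2) by auto
  moreover have "v (p' j) \<le> v (p' i)" if "1 \<le> i" "i \<le> j" "j \<le> card S" for i j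
  proof (cases "j = Suc n")
    case True
    have "p' i \<in> S"
      using \<open>bij_betw p' ({1..n} \<union> {Suc n}) ((S - {x}) \<union> {x})\<close> calculation(2,3) that
      by (metis atLeastAtMost_iff bij_betwE le_trans)
    then show ?thesis using True x by (simp add: p'_def)
  next
    case False
    then show ?thesis using that mono[of i j] Suc.hyps(2) by (simp add: p'_def)
  qed
  ultimately show ?case by auto
qed

section \<open>Waterman sequences and their partial sums\<close>

lemma waterman_pos: "waterman a \<Longrightarrow> 1 \<le> n \<Longrightarrow> 0 < a n"
  by (simp add: waterman_def)

lemma waterman_antimono: "waterman a \<Longrightarrow> antimono_on {1..} a"
  by (simp add: waterman_def)

lemma waterman_le: "waterman a \<Longrightarrow> 1 \<le> i \<Longrightarrow> i \<le> j \<Longrightarrow> a j \<le> a i"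
  using monotone_onD[OF waterman_antimono, of a i j] by simp

lemma waterman_sum_mono:
  assumes "waterman a" "i \<le> j"
  shows "sum a {1..i} \<le> sum a {1..j}"
  using assms waterman_pos[OF assms(1)] by (intro sum_mono2) (auto intro: less_imp_le)

lemma waterman_sum_nonneg: "waterman a \<Longrightarrow> 0 \<le> sum a {1..n}"
  using waterman_pos[of a] by (intro sum_nonneg) (auto intro: less_imp_le)

lemma waterman_sum_pos: "waterman a \<Longrightarrow> 1 \<le> n \<Longrightarrow> 0 < sum a {1..n}"
  using waterman_pos[of a] by (intro sum_pos) auto

lemma waterman_sum_at_top:
  assumes "waterman a"
  shows "filterlim (\<lambda>n. sum a {1..n}) at_top at_top"
proof -
  have "\<exists>N. C \<le> sum a {1..N}" for C
  proof (rule ccontr)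
    assume "\<not> ?thesis"
    then have "sum a {1..Suc n} \<le> C" for n
      by (meson le_cases)
    then have "(\<Sum>i\<le>n. a (Suc i)) \<le> C" for n
      unfolding lessThan_Suc_atMost[symmetric] sum.atLeast1_atMost_eq[folded One_nat_def] .
    then have "summable (\<lambda>n. a (Suc n))"
      using waterman_pos[OF assms] by (intro bounded_imp_summable[of _ C])
        (simp_all add: less_imp_le)
    then show False using assms by (simp add: waterman_def)
  qed
  then show ?thesis
    unfolding filterlim_at_top eventually_sequentially
    by (meson order_trans waterman_sum_mono[OF assms])
qed

section \<open>Estimating the variation by finite families of intervals\<close>

lemma wvar_ge_sum:
  assumes a: "\<And>n. 1 \<le> n \<Longrightarrow> 0 \<le> a n"
    and st: "\<And>i. 1 \<le> i \<Longrightarrow> i \<le> m \<Longrightarrow> 0 \<le> s i \<and> s i \<le> t i \<and> t i \<le> 1"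
    and disj: "disjoint_family_on (\<lambda>i. {s i<..<t i}) {1..m}"
  shows "ennreal (\<Sum>i=1..m. a i * \<bar>x (t i) - x (s i)\<bar>) \<le> wvar a x"
proof -
  \<comment> \<open>Padding with the degenerate interval at \<open>0\<close>, which has empty
    interior and contributes nothing, makes the finite family infinite.\<close>
  define s' where "s' = (\<lambda>i. if i \<in> {1..m} then s i else 0)"
  define t' where "t' = (\<lambda>i. if i \<in> {1..m} then t i else 0)"
  define V where "V = (\<lambda>n. ennreal (a (Suc n) * \<bar>x (t' (Suc n)) - x (s' (Suc n))\<bar>))"
  have "(s', t') \<in> interval_seqs"
    using st disj unfolding interval_seqs_def s'_def t'_def disjoint_family_on_def
    by (auto simp del: greaterThanLessThan_iff Int_greaterThanLessThan)
  have "(\<Sum>i=1..m. a i * \<bar>x (t i) - x (s i)\<bar>) = (\<Sum>i=1..m. a i * \<bar>x (t' i) - x (s' i)\<bar>)"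
    by (intro sum.cong) (auto simp: s'_def t'_def)
  also have "ennreal \<dots> = (\<Sum>i<m. V i)"
    unfolding V_def sum.atLeast1_atMost_eq[folded One_nat_def] using a by (subst sum_ennreal) auto
  also have "\<dots> \<le> suminf V"
    by (intro sum_le_suminf) auto
  also have "\<dots> \<le> wvar a x"
    unfolding wvar_def V_def using \<open>(s', t') \<in> interval_seqs\<close>
    by (intro SUP_upper2[of "(s', t')"]) auto
  finally show ?thesis .
qed

lemma interval_seqsD:
  assumes "(s, t) \<in> interval_seqs" "1 \<le> i"
  shows "0 \<le> s i" "s i \<le> t i" "t i \<le> 1"
  using assms by (auto simp: interval_seqs_def)

lemma wvar_le:
  assumes a: "\<And>n. 1 \<le> n \<Longrightarrow> 0 \<le> a n"
    and le: "\<And>s t m. (s, t) \<in> interval_seqs \<Longrightarrow>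
               ennreal (\<Sum>i=1..m. a i * \<bar>x (t i) - x (s i)\<bar>) \<le> C"
  shows "wvar a x \<le> C"
  unfolding wvar_def
proof (rule SUP_least, clarify)
  fix s t assume st: "(s, t) \<in> interval_seqs"
  show "(\<Sum>n. ennreal (a (Suc n) * \<bar>x (t (Suc n)) - x (s (Suc n))\<bar>)) \<le> C"
  proof (rule suminf_le_const)
    fix m
    have "(\<Sum>i<m. ennreal (a (Suc i) * \<bar>x (t (Suc i)) - x (s (Suc i))\<bar>))
        = ennreal (\<Sum>i=1..m. a i * \<bar>x (t i) - x (s i)\<bar>)"
      unfolding sum.atLeast1_atMost_eq[folded One_nat_def] using a by (subst sum_ennreal) auto
    then show "(\<Sum>i<m. ennreal (a (Suc i) * \<bar>x (t (Suc i)) - x (s (Suc i))\<bar>)) \<le> C"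
      using le[OF st] by simp
  qed simp
qed

lemma wvar_cong: "(\<And>t. t \<in> {0..1} \<Longrightarrow> x t = y t) \<Longrightarrow> wvar a x = wvar a y"
  unfolding wvar_def
proof (intro SUP_cong refl, clarify)
  fix s t assume xy: "\<And>t. t \<in> {0..1} \<Longrightarrow> x t = y t" and st: "(s, t) \<in> interval_seqs"
  have "x (s (Suc n)) = y (s (Suc n))" "x (t (Suc n)) = y (t (Suc n))" for n
    using interval_seqsD[OF st, of "Suc n"] by (auto intro!: xy)
  then show "(\<Sum>n. ennreal (a (Suc n) * \<bar>x (t (Suc n)) - x (s (Suc n))\<bar>))
      = (\<Sum>n. ennreal (a (Suc n) * \<bar>y (t (Suc n)) - y (s (Suc n))\<bar>))"
    by simp
qed

text \<open>A permutation \<open>p\<close> sorting the increments decreasingly makes summation by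
  parts applicable, and the permuted intervals still compete for \<open>wvar a x\<close>. The
  constant \<beta> is charged to the largest increment only, which is at most
  \<open>2 * \<delta>\<close>.\<close>

lemma wvar_interpolation:
  assumes a: "waterman a" and b: "waterman b" and nonneg: "0 \<le> \<beta>" "0 \<le> e"
    and ab: "\<And>k. sum b {1..k} \<le> \<beta> + e * sum a {1..k}"
    and x: "\<And>t. t \<in> {0..1} \<Longrightarrow> \<bar>x t\<bar> \<le> \<delta>"
  shows "wvar b x \<le> ennreal (2 * \<beta> * \<delta>) + ennreal e * wvar a x"
proof (rule wvar_le)
  fix s t m assume st: "(s, t) \<in> interval_seqs"
  define v where "v = (\<lambda>i. \<bar>x (t i) - x (s i)\<bar>)"
  have d: "0 \<le> \<delta>" using x[of 0] by simp
  have v: "v i \<le> 2 * \<delta>" if "1 \<le> i" for i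
    using x[of "s i"] x[of "t i"] interval_seqsD[OF st that] by (simp add: v_def)
  obtain p where p: "bij_betw p {1..m} {1..m}"
    and mono: "\<And>i j. 1 \<le> i \<Longrightarrow> i \<le> j \<Longrightarrow> j \<le> m \<Longrightarrow> v (p j) \<le> v (p i)"
    using ex_antimono_enumeration[of "{1..m}" v] by auto
  have pin: "p i \<in> {1..m}" if "i \<in> {1..m}" for i
    using p that by (rule bij_betwE[THEN bspec])
  \<comment> \<open>All of \<beta> sits on index \<open>1\<close>, so each nonempty initial sum of
    \<open>q\<close> is exactly the bound assumed for \<open>b\<close>; the empty one is
    \<open>0\<close>.\<close>
  define q where "q = (\<lambda>i::nat. e * a i + (if i = 1 then \<beta> else 0))"
  have q: "sum q {1..k} = e * sum a {1..k} + (if 1 \<le> k then \<beta> else 0)" for k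
    by (simp add: q_def sum.distrib sum_distrib_left)
  have "(\<Sum>i=1..m. b i * v i) = (\<Sum>i=1..m. b (p i) * v (p i))"
    by (rule sum.reindex_bij_betw[OF p, symmetric])
  also have "\<dots> \<le> (\<Sum>i=1..m. q i * v (p i))"
  proof (rule sum_mult_antimono_mono)
    fix k assume "k \<le> m"
    then have inj: "inj_on p {1..k}"
      using p by (auto simp: bij_betw_def intro: inj_on_subset)
    have "(\<Sum>i=1..k. b (p i)) = sum b (p ` {1..k})"
      using inj by (simp add: sum.reindex)
    also have "\<dots> \<le> sum b {1..card (p ` {1..k})}"
    proof (rule sum_antimono_le_initial[OF waterman_antimono[OF b]])
      show "p ` {1..k} \<subseteq> {1..}" using pin \<open>k \<le> m\<close> by force
    qed simp
    also have "\<dots> = sum b {1..k}" using inj by (simp add: card_image)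
    also have "\<dots> \<le> sum q {1..k}" using ab[of k] by (cases "k = 0") (simp_all add: q del: One_nat_def)
    finally show "(\<Sum>i=1..k. b (p i)) \<le> sum q {1..k}" .
  qed (use mono in \<open>auto simp: v_def\<close>)
  also have "\<dots> = e * (\<Sum>i=1..m. a i * v (p i)) + (\<Sum>i=1..m. if i = 1 then \<beta> * v (p 1) else 0)"
    unfolding q_def sum_distrib_left sum.distrib[symmetric]
    by (intro sum.cong) (auto simp: algebra_simps)
  also have "(\<Sum>i=1..m. if i = 1 then \<beta> * v (p 1) else 0) \<le> 2 * \<beta> * \<delta>"
    using v[of "p 1"] pin[of 1] nonneg d mult_left_mono[of "v (p 1)" "2 * \<delta>" \<beta>]
    by (cases "m = 0") (auto simp: algebra_simps)
  finally have *: "(\<Sum>i=1..m. b i * v i) \<le> 2 * \<beta> * \<delta> + e * (\<Sum>i=1..m. a i * v (p i))"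
    by simp
  have sum0: "0 \<le> (\<Sum>i=1..m. a i * v (p i))"
    using waterman_pos[OF a] by (intro sum_nonneg mult_nonneg_nonneg) (auto simp: v_def less_imp_le)
  have "disjoint_family_on (\<lambda>i. {s (p i)<..<t (p i)}) {1..m}"
    unfolding disjoint_family_on_def
  proof (intro ballI impI)
    fix i j assume ij: "i \<in> {1..m}" "j \<in> {1..m}" "i \<noteq> j"
    then have "p i \<noteq> p j" using p by (auto simp: bij_betw_def dest: inj_onD)
    then show "{s (p i)<..<t (p i)} \<inter> {s (p j)<..<t (p j)} = {}"
      using st pin[OF ij(1)] pin[OF ij(2)] by (auto simp: interval_seqs_def disjoint_family_on_def)
  qed
  then have "ennreal (\<Sum>i=1..m. a i * \<bar>x ((t \<circ> p) i) - x ((s \<circ> p) i)\<bar>) \<le> wvar a x"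
    using interval_seqsD[OF st] pin waterman_pos[OF a]
    by (intro wvar_ge_sum) (auto intro: less_imp_le)
  then have A: "ennreal (\<Sum>i=1..m. a i * v (p i)) \<le> wvar a x"
    by (simp add: v_def)
  have "ennreal (\<Sum>i=1..m. b i * v i) \<le> ennreal (2 * \<beta> * \<delta> + e * (\<Sum>i=1..m. a i * v (p i)))"
    using * by (rule ennreal_leI)
  also have "\<dots> = ennreal (2 * \<beta> * \<delta>) + ennreal e * ennreal (\<Sum>i=1..m. a i * v (p i))"
    using nonneg d sum0 by (simp add: ennreal_mult ennreal_plus)
  also have "\<dots> \<le> ennreal (2 * \<beta> * \<delta>) + ennreal e * wvar a x"
    using A by (intro add_left_mono mult_left_mono) auto
  finally show "ennreal (\<Sum>i=1..m. b i * \<bar>x (t i) - x (s i)\<bar>)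
      \<le> ennreal (2 * \<beta> * \<delta>) + ennreal e * wvar a x"
    by (simp add: v_def)
qed (use waterman_pos[OF b] in \<open>simp add: less_imp_le\<close>)

section \<open>Spike functions as test functions\<close>

definition spikes :: "real set \<Rightarrow> real \<Rightarrow> real \<Rightarrow> real" where
  "spikes P h = (\<lambda>t\<in>{0..1}. if t \<in> P then h else 0)"

text \<open>A point of \<open>P\<close> is the left endpoint of at most one nondegenerate interval
  of the family, and the right endpoint of at most one. Hence at most \<open>2 * card P\<close>
  intervals see a change, each of size at most \<open>h\<close>.\<close>

lemma wvar_spikes_le:
  assumes a: "waterman a" and P: "finite P" and h: "0 \<le> h"
  shows "wvar a (spikes P h) \<le> ennreal (h * sum a {1..2 * card P})"
proof (rule wvar_le)
  fix s t m assume st: "(s, t) \<in> interval_seqs"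
  define J where "J = (\<lambda>u. {i \<in> {1..m}. s i < t i \<and> u i \<in> P})"
  have card: "card (J u) \<le> card P" if "u = s \<or> u = t" for u
  proof (rule card_inj_on_le)
    show "inj_on u (J u)"
    proof (rule inj_onI, rule ccontr)
      fix i j assume ij: "i \<in> J u" "j \<in> J u" "u i = u j" "i \<noteq> j"
      then have "{s i<..<t i} \<inter> {s j<..<t j} = {}"
        using st by (auto simp: interval_seqs_def disjoint_family_on_def J_def)
      \<comment> \<open>Nondegenerate intervals sharing a left, or a right, endpoint overlap: this
        midpoint lies in both interiors.\<close>
      moreover have "(max (s i) (s j) + min (t i) (t j)) / 2 \<in> {s i<..<t i} \<inter> {s j<..<t j}"
        using ij that by (auto simp: J_def max_def min_def field_simps)
      ultimately show False by blast
    qed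
  qed (use P in \<open>auto simp: J_def\<close>)
  define U where "U = J s \<union> J t"
  have U: "finite U" "U \<subseteq> {1..m}" by (auto simp: U_def J_def)
  have "card U \<le> 2 * card P"
    using card_Un_le[of "J s" "J t"] card[of s] card[of t] by (simp add: U_def)
  have "(\<Sum>i=1..m. a i * \<bar>spikes P h (t i) - spikes P h (s i)\<bar>)
      = (\<Sum>i\<in>U. a i * \<bar>spikes P h (t i) - spikes P h (s i)\<bar>)"
  proof (rule sum.mono_neutral_right)
    show "\<forall>i\<in>{1..m} - U. a i * \<bar>spikes P h (t i) - spikes P h (s i)\<bar> = 0"
    proof
      fix i assume i: "i \<in> {1..m} - U"
      then have "s i = t i \<or> (s i \<notin> P \<and> t i \<notin> P)"
        using interval_seqsD(2)[OF st, of i] by (auto simp: U_def J_def)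
      then show "a i * \<bar>spikes P h (t i) - spikes P h (s i)\<bar> = 0"
        using interval_seqsD[OF st, of i] i by (auto simp: spikes_def)
    qed
  qed (use U in auto)
  also have "\<dots> \<le> (\<Sum>i\<in>U. a i * h)"
  proof (rule sum_mono)
    fix i assume "i \<in> U"
    then have "1 \<le> i" using U by auto
    then show "a i * \<bar>spikes P h (t i) - spikes P h (s i)\<bar> \<le> a i * h"
      using h waterman_pos[OF a, of i] interval_seqsD[OF st, of i]
      by (intro mult_left_mono) (auto simp: spikes_def)
  qed
  also have "\<dots> = h * sum a U" by (simp add: sum_distrib_left mult.commute)
  also have "\<dots> \<le> h * sum a {1..2 * card P}"
  proof (rule mult_left_mono[OF _ h])
    have "sum a U \<le> sum a {1..card U}"
      using U by (intro sum_antimono_le_initial waterman_antimono[OF a]) auto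
    also have "\<dots> \<le> sum a {1..2 * card P}"
      by (rule waterman_sum_mono[OF a]) fact
    finally show "sum a U \<le> sum a {1..2 * card P}" .
  qed
  finally show "ennreal (\<Sum>i=1..m. a i * \<bar>spikes P h (t i) - spikes P h (s i)\<bar>)
      \<le> ennreal (h * sum a {1..2 * card P})"
    by (rule ennreal_leI)
qed (use waterman_pos[OF a] in \<open>simp add: less_imp_le\<close>)

definition even_reciprocals :: "nat \<Rightarrow> real set" where
  "even_reciprocals n = (\<lambda>i. 1 / (2 * real i)) ` {1..n}"

lemma card_even_reciprocals: "card (even_reciprocals n) = n"
  unfolding even_reciprocals_def by (subst card_image) (auto intro!: inj_onI)

text \<open>The intervals from \<open>1 / (2 * i + 1)\<close> to \<open>1 / (2 * i)\<close> do not
  overlap. By parity each starts at a zero and ends on a spike, so every increment is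
  \<open>h\<close>.\<close>

lemma wvar_spikes_even_reciprocals_ge:
  assumes b: "waterman b" and h: "0 \<le> h"
  shows "ennreal (h * sum b {1..n}) \<le> wvar b (spikes (even_reciprocals n) h)"
proof -
  define s t where "s = (\<lambda>i. 1 / (2 * real i + 1))" and "t = (\<lambda>i. 1 / (2 * real i))"
  have sP: "s i \<notin> even_reciprocals n" for i
  proof
    assume "s i \<in> even_reciprocals n"
    then obtain j where "j \<ge> 1" "1 / (2 * real i + 1) = 1 / (2 * real j)"
      by (auto simp: even_reciprocals_def s_def)
    then have "real (2 * i + 1) = real (2 * j)" by (simp add: field_simps)
    then have "2 * i + 1 = 2 * j" by (rule of_nat_eq_iff[THEN iffD1])
    then show False by presburger
  qed
  have tP: "t i \<in> even_reciprocals n" if "i \<in> {1..n}" for i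
    using that by (auto simp: even_reciprocals_def t_def)
  have st: "0 \<le> s i \<and> s i \<le> t i \<and> t i \<le> 1" if "1 \<le> i" for i
    using that by (auto simp: s_def t_def field_simps)
  have t_le: "t j \<le> s i" if "1 \<le> i" "i < j" for i j
  proof -
    have "2 * real i + 1 \<le> 2 * real j" using that by linarith
    then show ?thesis using that unfolding s_def t_def by (intro divide_left_mono) auto
  qed
  have "disjoint_family_on (\<lambda>i. {s i<..<t i}) {1..n}"
    unfolding disjoint_family_on_def
  proof (intro ballI impI)
    fix i j assume "i \<in> {1..n}" "j \<in> {1..n}" "i \<noteq> j"
    then show "{s i<..<t i} \<inter> {s j<..<t j} = {}"
      using t_le[of i j] t_le[of j i] by (cases i j rule: linorder_cases) auto
  qed
  then have "ennreal (\<Sum>i=1..n. b i * \<bar>spikes (even_reciprocals n) h (t i)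
                                   - spikes (even_reciprocals n) h (s i)\<bar>)
      \<le> wvar b (spikes (even_reciprocals n) h)"
    using st waterman_pos[OF b] by (intro wvar_ge_sum) (auto simp: less_imp_le)
  also have "(\<Sum>i=1..n. b i * \<bar>spikes (even_reciprocals n) h (t i)
                                   - spikes (even_reciprocals n) h (s i)\<bar>) = h * sum b {1..n}"
    unfolding sum_distrib_left
  proof (intro sum.cong refl)
    fix i assume i: "i \<in> {1..n}"
    then show "b i * \<bar>spikes (even_reciprocals n) h (t i)
                      - spikes (even_reciprocals n) h (s i)\<bar> = h * b i"
      using st[of i] sP[of i] tP[of i] h by (simp add: spikes_def)
  qed
  finally show ?thesis .
qed

text \<open>The constant \<beta> absorbs the finitely many early \<open>n\<close>; conversely it
  becomes negligible because the partial sums of \<open>a\<close> diverge.\<close>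

lemma sum_ratio_tendsto_0_iff:
  assumes a: "waterman a" and b: "waterman b"
  shows "(\<lambda>n. sum b {1..n} / sum a {1..n}) \<longlonglongrightarrow> 0
    \<longleftrightarrow> (\<forall>e>0. \<exists>\<beta>. \<forall>n. sum b {1..n} \<le> \<beta> + e * sum a {1..n})"
    (is "?L \<longleftrightarrow> ?R")
proof
  assume ?L
  show ?R
  proof (intro allI impI)
    fix e :: real assume e: "0 < e"
    obtain N where N: "\<And>n. N \<le> n \<Longrightarrow> \<bar>sum b {1..n} / sum a {1..n}\<bar> < e"
      using LIMSEQ_D[OF \<open>?L\<close> e] by auto
    have "sum b {1..n} \<le> sum b {1..Suc N} + e * sum a {1..n}" for n
    proof (cases "n \<le> Suc N")
      case True
      have "0 \<le> e * sum a {1..n}" using e waterman_sum_nonneg[OF a] by simp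
      then show ?thesis using waterman_sum_mono[OF b True] by linarith
    next
      case False
      then have "sum b {1..n} / sum a {1..n} < e"
        by (intro order_le_less_trans[OF abs_ge_self N]) simp
      then have "sum b {1..n} < e * sum a {1..n}"
        using waterman_sum_pos[OF a, of n] False by (simp add: divide_less_eq)
      then show ?thesis using waterman_sum_nonneg[OF b, of "Suc N"] by linarith
    qed
    then show "\<exists>\<beta>. \<forall>n. sum b {1..n} \<le> \<beta> + e * sum a {1..n}" by blast
  qed
next
  assume R: ?R
  show ?L
  proof (rule LIMSEQ_I)
    fix e :: real assume e: "0 < e"
    then obtain \<beta> where \<beta>: "\<And>n. sum b {1..n} \<le> \<beta> + e / 2 * sum a {1..n}"
      using R half_gt_zero by blast
    obtain N where N: "\<And>n. N \<le> n \<Longrightarrow> 2 * \<beta> / e + 1 \<le> sum a {1..n}"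
      using waterman_sum_at_top[OF a] unfolding filterlim_at_top eventually_sequentially by blast
    show "\<exists>no. \<forall>n\<ge>no. norm (sum b {1..n} / sum a {1..n} - 0) < e"
    proof (intro exI allI impI)
      \<comment> \<open>Starting at \<open>Suc N\<close> excludes \<open>n = 0\<close>, where the
        denominator vanishes.\<close>
      fix n assume n: "Suc N \<le> n"
      then have pos: "0 < sum a {1..n}" using waterman_sum_pos[OF a] by simp
      have "2 * \<beta> / e < sum a {1..n}" using N[of n] n by simp
      then have "\<beta> < e / 2 * sum a {1..n}" using e by (simp add: field_simps)
      then have "sum b {1..n} < e * sum a {1..n}" using \<beta>[of n] by (simp add: field_simps)
      then show "norm (sum b {1..n} / sum a {1..n} - 0) < e"
        using pos waterman_sum_nonneg[OF b, of n] by (simp add: divide_less_eq)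
    qed
  qed
qed

section \<open>Compactness in the supremum norm and in the Waterman norm\<close>

lemma wvar_diff_le:
  assumes "waterman a"
  shows "wvar a (x - y) \<le> wvar a x + wvar a y"
proof -
  have "wvar a (x - y) \<le> wvar a (x - (\<lambda>_. 0)) + wvar a ((\<lambda>_. 0) - y)"
    by (rule wvar_triangle[OF assms])
  also have "\<dots> = wvar a x + wvar a y"
    by (subst wvar_minus_commute[of a "\<lambda>_. 0" y]) (simp add: fun_diff_def)
  finally show ?thesis .
qed

text \<open>Lower semicontinuity of the variation: on a fixed finite family, replacing
  \<open>y\<close> by an \<open>r\<close>-close \<open>x\<close> costs at most
  \<open>2 * r * sum a {1..m}\<close>, and \<open>r\<close> may depend on the family.\<close>

lemma wvar_le_of_uniform_approx:
  assumes a: "waterman a" and c: "0 \<le> c"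
    and approx: "\<And>r. 0 < r \<Longrightarrow> \<exists>x. wvar a x \<le> ennreal c \<and> (\<forall>t\<in>{0..1}. \<bar>y t - x t\<bar> \<le> r)"
  shows "wvar a y \<le> ennreal c"
proof (rule wvar_le)
  fix s t m assume st: "(s, t) \<in> interval_seqs"
  have "(\<Sum>i=1..m. a i * \<bar>y (t i) - y (s i)\<bar>) \<le> c + e" if e: "0 < e" for e
  proof -
    \<comment> \<open>The added \<open>1\<close> keeps the denominator positive for
      \<open>m = 0\<close>.\<close>
    define r where "r = e / (2 * sum a {1..m} + 1)"
    have A: "0 \<le> sum a {1..m}" by (rule waterman_sum_nonneg[OF a])
    then have r: "0 < r" using e by (simp add: r_def)
    have "2 * r * sum a {1..m} \<le> e"
      using A e by (simp add: r_def field_simps)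
    obtain x where x: "wvar a x \<le> ennreal c" and near: "\<And>t. t \<in> {0..1} \<Longrightarrow> \<bar>y t - x t\<bar> \<le> r"
      using approx[OF r] by blast
    have "ennreal (\<Sum>i=1..m. a i * \<bar>x (t i) - x (s i)\<bar>) \<le> wvar a x"
      using st waterman_pos[OF a]
      by (intro wvar_ge_sum) (auto simp: interval_seqs_def disjoint_family_on_def less_imp_le)
    then have "ennreal (\<Sum>i=1..m. a i * \<bar>x (t i) - x (s i)\<bar>) \<le> ennreal c"
      using x by simp
    then have le: "(\<Sum>i=1..m. a i * \<bar>x (t i) - x (s i)\<bar>) \<le> c"
      using c by simp
    have "(\<Sum>i=1..m. a i * \<bar>y (t i) - y (s i)\<bar>)
        \<le> (\<Sum>i=1..m. a i * (\<bar>x (t i) - x (s i)\<bar> + 2 * r))"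
    proof (intro sum_mono mult_left_mono)
      fix i assume i: "i \<in> {1..m}"
      then show "\<bar>y (t i) - y (s i)\<bar> \<le> \<bar>x (t i) - x (s i)\<bar> + 2 * r"
        using near[of "s i"] near[of "t i"] interval_seqsD[OF st, of i] by simp
      show "0 \<le> a i" using i waterman_pos[OF a, of i] by simp
    qed
    also have "\<dots> = (\<Sum>i=1..m. a i * \<bar>x (t i) - x (s i)\<bar>) + 2 * r * sum a {1..m}"
      by (simp add: distrib_left sum.distrib sum_distrib_left mult_ac)
    finally show ?thesis using le \<open>2 * r * sum a {1..m} \<le> e\<close> by linarith
  qed
  then have "(\<Sum>i=1..m. a i * \<bar>y (t i) - y (s i)\<bar>) \<le> c"
    by (rule field_le_epsilon)
  then show "ennreal (\<Sum>i=1..m. a i * \<bar>y (t i) - y (s i)\<bar>) \<le> ennreal c"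
    by (rule ennreal_leI)
qed (use waterman_pos[OF a] in \<open>simp add: less_imp_le\<close>)

lemma wvar_le_wnorm:
  assumes "x \<in> wspace a"
  shows "wvar a x \<le> ennreal (wnorm a x)"
proof -
  have "wvar a x = ennreal (enn2real (wvar a x))"
    using assms by (simp add: wspace_def)
  also have "\<dots> \<le> ennreal (wnorm a x)"
    by (intro ennreal_leI) (simp add: wnorm_def)
  finally show ?thesis .
qed

text \<open>The summand \<open>1\<close> in the factor of \<delta> pays for
  \<open>\<bar>x 0\<bar>\<close>. Finiteness is a separate conclusion because
  \<open>enn2real\<close> sends infinity to \<open>0\<close>.\<close>

lemma wnorm_le_interpolation:
  assumes a: "waterman a" and b: "waterman b" and nonneg: "0 \<le> e" "0 \<le> \<beta>" "0 \<le> c"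
    and ab: "\<And>k. sum b {1..k} \<le> \<beta> + e * sum a {1..k}"
    and x: "\<And>t. t \<in> {0..1} \<Longrightarrow> \<bar>x t\<bar> \<le> \<delta>" "wvar a x \<le> ennreal c"
  shows "wvar b x < \<infinity>" "wnorm b x \<le> (1 + 2 * \<beta>) * \<delta> + e * c"
proof -
  have d: "0 \<le> \<delta>" using x(1)[of 0] by simp
  have "wvar b x \<le> ennreal (2 * \<beta> * \<delta>) + ennreal e * wvar a x"
    by (rule wvar_interpolation[OF a b nonneg(2,1) ab x(1)])
  also have "\<dots> \<le> ennreal (2 * \<beta> * \<delta>) + ennreal e * ennreal c"
    using x(2) by (intro add_left_mono mult_left_mono) auto
  also have "\<dots> = ennreal (2 * \<beta> * \<delta> + e * c)"
    using nonneg d by (simp add: ennreal_mult ennreal_plus)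
  finally have le: "wvar b x \<le> ennreal (2 * \<beta> * \<delta> + e * c)" .
  then show fin: "wvar b x < \<infinity>" by (simp add: le_less_trans)
  have "enn2real (wvar b x) \<le> enn2real (ennreal (2 * \<beta> * \<delta> + e * c))"
    using le by (intro enn2real_mono) auto
  also have "\<dots> = 2 * \<beta> * \<delta> + e * c" using nonneg d by (intro enn2real_ennreal) simp
  finally show "wnorm b x \<le> (1 + 2 * \<beta>) * \<delta> + e * c"
    using x(1)[of 0] by (simp add: wnorm_def algebra_simps)
qed

section \<open>The ratio condition gives compactness\<close>

text \<open>The uniform closure \<open>T\<close> of \<open>K\<close> keeps the bound
  \<open>c\<close> on the \<open>a\<close>-variation, so by interpolation a uniformly convergent
  sequence in \<open>T\<close> also converges in the norm of \<open>wspace b\<close>. Thus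
  \<open>T\<close> is compact there.\<close>

lemma relatively_compact_wspace:
  assumes a: "waterman a" and b: "waterman b"
    and lim: "(\<lambda>n. sum b {1..n} / sum a {1..n}) \<longlonglongrightarrow> 0"
    and K: "K \<subseteq> wspace a" "\<And>x. x \<in> K \<Longrightarrow> wnorm a x \<le> c" "0 \<le> c"
    and cpt: "relatively_compact_in (norm_topology bfun_space sup_norm) K"
  shows "K \<subseteq> wspace b" "relatively_compact_in (norm_topology (wspace b) (wnorm b)) K"
proof -
  interpret S: Metric_space bfun_space "\<lambda>x y. sup_norm (x - y)"
    by (rule Metric_space_bfun_space)
  interpret W: Metric_space "wspace b" "\<lambda>x y. wnorm b (x - y)"
    by (rule Metric_space_wspace[OF b])
  define T where "T = S.mtopology closure_of K"
  have ex_const: "\<exists>\<beta>\<ge>0. \<forall>k. sum b {1..k} \<le> \<beta> + e * sum a {1..k}" if e: "0 < e" for e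
  proof -
    obtain \<beta> where \<beta>: "\<And>k. sum b {1..k} \<le> \<beta> + e * sum a {1..k}"
      using lim e unfolding sum_ratio_tendsto_0_iff[OF a b] by blast
    then show ?thesis using \<beta>[of 0] by auto
  qed
  have cptT: "compactin S.mtopology T" and "K \<subseteq> bfun_space"
    using cpt by (auto simp: relatively_compact_in_def norm_topology_def T_def)
  have "K \<subseteq> T"
    using closure_of_subset[of K S.mtopology] \<open>K \<subseteq> bfun_space\<close> by (simp add: T_def)
  have T_bfun: "T \<subseteq> bfun_space"
    using compactin_subset_topspace[OF cptT] by simp
  have T_wvar: "wvar a y \<le> ennreal c" if "y \<in> T" for y
  proof (rule wvar_le_of_uniform_approx[OF a K(3)])
    fix r :: real assume "0 < r"
    then obtain x where x: "x \<in> K" "sup_norm (y - x) < r"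
      using \<open>y \<in> T\<close> unfolding T_def S.metric_closure_of by auto
    have "wvar a x \<le> ennreal c"
      using wvar_le_wnorm[of x a] K x(1) by (meson ennreal_leI order_trans subsetD)
    moreover have "\<bar>y t - x t\<bar> \<le> r" if "t \<in> {0..1}" for t
      using sup_norm_ge[OF _ _ that, of y x] x \<open>y \<in> T\<close> T_bfun \<open>K \<subseteq> T\<close> by force
    ultimately show "\<exists>x. wvar a x \<le> ennreal c \<and> (\<forall>t\<in>{0..1}. \<bar>y t - x t\<bar> \<le> r)" by blast
  qed
  have T_sub: "T \<subseteq> wspace b"
  proof
    fix y assume y: "y \<in> T"
    obtain \<beta> where \<beta>: "0 \<le> \<beta>" "\<And>k. sum b {1..k} \<le> \<beta> + 1 * sum a {1..k}"
      using ex_const[of 1] by auto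
    have "bounded (y ` {0..1})" using y T_bfun by (auto simp: bfun_space_def)
    then obtain \<delta> where \<delta>: "\<And>t. t \<in> {0..1} \<Longrightarrow> \<bar>y t\<bar> \<le> \<delta>"
      unfolding bounded_iff by (metis real_norm_def image_eqI)
    have "wvar b y < \<infinity>"
      using wnorm_le_interpolation(1)[OF a b _ \<beta>(1) K(3) \<beta>(2) \<delta> T_wvar[OF y]] by simp
    then show "y \<in> wspace b"
      using y T_bfun by (auto simp: wspace_def bfun_space_def)
  qed
  then show Kb: "K \<subseteq> wspace b" using \<open>K \<subseteq> T\<close> by blast
  have "compactin W.mtopology T"
    unfolding W.compactin_sequentially
  proof (intro conjI allI impI T_sub)
    fix \<sigma> :: "nat \<Rightarrow> real \<Rightarrow> real" assume \<sigma>: "range \<sigma> \<subseteq> T"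
    then obtain l r where l: "l \<in> T" and r: "strict_mono r"
      and conv: "limitin S.mtopology (\<sigma> \<circ> r) l sequentially"
      using cptT unfolding S.compactin_sequentially by blast
    have "limitin W.mtopology (\<sigma> \<circ> r) l sequentially"
      unfolding W.limit_metric_sequentially
    proof (intro conjI allI impI)
      show "l \<in> wspace b" using l T_sub by blast
      fix \<epsilon> :: real assume \<epsilon>: "0 < \<epsilon>"
      \<comment> \<open>The difference of two members of \<open>T\<close> has
        \<open>a\<close>-variation at most \<open>2 * c\<close>, so this \<open>e\<close> keeps its
        share below half of \<epsilon>, also for \<open>c = 0\<close>; \<delta> below takes the
        other half.\<close>
      define e where "e = \<epsilon> / (4 * c + 1)"
      have e: "0 < e" "e * (2 * c) < \<epsilon> / 2"
        using \<epsilon> K(3) by (auto simp: e_def field_simps)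
      obtain \<beta> where \<beta>: "0 \<le> \<beta>" "\<And>k. sum b {1..k} \<le> \<beta> + e * sum a {1..k}"
        using ex_const[OF e(1)] by auto
      define \<delta> where "\<delta> = \<epsilon> / (2 * (1 + 2 * \<beta>))"
      have \<delta>: "0 < \<delta>" "(1 + 2 * \<beta>) * \<delta> = \<epsilon> / 2"
        using \<epsilon> \<beta>(1) by (auto simp: \<delta>_def field_simps)
      obtain N where N: "\<And>n. N \<le> n \<Longrightarrow> sup_norm ((\<sigma> \<circ> r) n - l) < \<delta>"
        using conv \<delta>(1) unfolding S.limit_metric_sequentially by blast
      show "\<exists>N. \<forall>n\<ge>N. (\<sigma> \<circ> r) n \<in> wspace b \<and> wnorm b ((\<sigma> \<circ> r) n - l) < \<epsilon>"
      proof (intro exI allI impI conjI)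
        fix n assume n: "N \<le> n"
        have \<sigma>T: "(\<sigma> \<circ> r) n \<in> T" using \<sigma> by auto
        then show "(\<sigma> \<circ> r) n \<in> wspace b" using T_sub by blast
        have small: "\<bar>((\<sigma> \<circ> r) n - l) t\<bar> \<le> \<delta>" if "t \<in> {0..1}" for t
          using sup_norm_ge[OF _ _ that, of "(\<sigma> \<circ> r) n" l] N[OF n] \<sigma>T l T_bfun by force
        have "wvar a ((\<sigma> \<circ> r) n - l) \<le> wvar a ((\<sigma> \<circ> r) n) + wvar a l"
          by (rule wvar_diff_le[OF a])
        also have "\<dots> \<le> ennreal c + ennreal c"
          by (intro add_mono T_wvar \<sigma>T l)
        also have "\<dots> = ennreal (2 * c)" using K(3) by (simp flip: ennreal_plus)
        finally have var: "wvar a ((\<sigma> \<circ> r) n - l) \<le> ennreal (2 * c)" .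
        have "wnorm b ((\<sigma> \<circ> r) n - l) \<le> (1 + 2 * \<beta>) * \<delta> + e * (2 * c)"
          using e(1) K(3) by (intro wnorm_le_interpolation(2)[OF a b _ \<beta>(1) _ \<beta>(2) small var]) auto
        then show "wnorm b ((\<sigma> \<circ> r) n - l) < \<epsilon>" using \<delta> e by linarith
      qed
    qed
    then show "\<exists>l r. l \<in> T \<and> strict_mono r \<and> limitin W.mtopology (\<sigma> \<circ> r) l sequentially"
      using l r by blast
  qed
  \<comment> \<open>A compact set is closed in a metric space, so \<open>T\<close> contains the
    closure of \<open>K\<close> for the new norm.\<close>
  moreover have "W.mtopology closure_of K \<subseteq> T"
    using calculation compactin_imp_closedin[OF W.Hausdorff_space_mtopology]
    by (intro closure_of_minimal \<open>K \<subseteq> T\<close>) blast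
  ultimately have "compactin W.mtopology (W.mtopology closure_of K)"
    by (rule closed_compactin) simp
  then show "relatively_compact_in (norm_topology (wspace b) (wnorm b)) K"
    using Kb by (simp add: relatively_compact_in_def norm_topology_def)
qed

section \<open>Compactness gives the ratio condition\<close>

lemma sup_norm_le:
  assumes "\<And>t. t \<in> {0..1} \<Longrightarrow> \<bar>x t\<bar> \<le> c"
  shows "sup_norm x \<le> c"
proof -
  have "bounded (x ` {0..1})"
    unfolding bounded_iff using assms by (intro exI[of _ c]) auto
  then show ?thesis
    by (subst sup_norm_eq_SUP) (auto intro!: cSUP_least assms)
qed

text \<open>The single interval \<open>[0, t]\<close> with weight \<open>b 1\<close> suffices. Norm
  convergence therefore forces pointwise convergence, which identifies limits.\<close>

lemma abs_le_wnorm: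
  assumes b: "waterman b" and fin: "wvar b x < \<infinity>" and t: "t \<in> {0..1}"
  shows "\<bar>x t\<bar> \<le> (1 + 1 / b 1) * wnorm b x"
proof -
  have b1: "0 < b 1" using waterman_pos[OF b] by simp
  have "enn2real (ennreal (b 1 * \<bar>x t - x 0\<bar>)) \<le> enn2real (wvar b x)"
    using wvar_ge[OF t] fin by (intro enn2real_mono) auto
  then have "\<bar>x t - x 0\<bar> \<le> enn2real (wvar b x) / b 1"
    using b1 by (simp add: field_simps)
  also have "\<dots> \<le> wnorm b x / b 1"
    using b1 by (intro divide_right_mono) (auto simp: wnorm_def)
  finally have "\<bar>x t - x 0\<bar> \<le> wnorm b x / b 1" .
  moreover have "\<bar>x 0\<bar> \<le> wnorm b x" by (simp add: wnorm_def)
  ultimately show ?thesis by (simp add: distrib_right)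
qed

lemma spikes_in_wspace:
  assumes "waterman a" "finite P" "0 \<le> h"
  shows "spikes P h \<in> wspace a"
proof -
  have "wvar a (spikes P h) < \<infinity>"
    using wvar_spikes_le[OF assms] by (rule le_less_trans) simp
  then show ?thesis by (simp add: wspace_def spikes_def)
qed

text \<open>If the ratio stays above \<epsilon> along \<open>\<nu>\<close>, spikes of height
  \<open>h\<close> form a sequence tending uniformly to \<open>0\<close>, so any limit of a
  subsequence in \<open>wspace b\<close> is \<open>0\<close> on \<open>[0,1]\<close>; but the
  \<open>b\<close>-variations stay at least \<epsilon>.\<close>

lemma sum_ratio_tendsto_0_of_compactness:
  assumes a: "waterman a" and b: "waterman b"
    and compactness: "\<And>K c. K \<subseteq> wspace a \<Longrightarrow> \<forall>x\<in>K. wnorm a x \<le> c \<Longrightarrow>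
          relatively_compact_in (norm_topology bfun_space sup_norm) K \<Longrightarrow>
          relatively_compact_in (norm_topology (wspace b) (wnorm b)) K"
  shows "(\<lambda>n. sum b {1..n} / sum a {1..n}) \<longlonglongrightarrow> 0"
proof (rule ccontr)
  assume "\<not> ?thesis"
  then obtain \<epsilon> where \<epsilon>: "0 < \<epsilon>"
    and often: "\<And>N. \<exists>n\<ge>N. \<epsilon> \<le> norm (sum b {1..n} / sum a {1..n} - 0)"
    unfolding LIMSEQ_iff by (meson not_less)
  have "\<exists>n\<ge>Suc N. \<epsilon> \<le> sum b {1..n} / sum a {1..n}" for N
    using often[of "Suc N"] waterman_sum_nonneg[OF a] waterman_sum_nonneg[OF b] by auto
  then obtain \<nu> where \<nu>: "\<And>N. Suc N \<le> \<nu> N" "\<And>N. \<epsilon> \<le> sum b {1..\<nu> N} / sum a {1..\<nu> N}"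
    by metis
  interpret S: Metric_space bfun_space "\<lambda>x y. sup_norm (x - y)"
    by (rule Metric_space_bfun_space)
  interpret W: Metric_space "wspace b" "\<lambda>x y. wnorm b (x - y)"
    by (rule Metric_space_wspace[OF b])
  define h where "h = (\<lambda>N. 1 / sum a {1..\<nu> N})"
  define \<sigma> where "\<sigma> = (\<lambda>N. spikes (even_reciprocals (\<nu> N)) (h N))"
  define z where "z = spikes {} 0"
  \<comment> \<open>Adding the limit \<open>z\<close>, the zero function on \<open>[0,1]\<close>,
    makes \<open>K\<close> compact in the supremum norm.\<close>
  define K where "K = insert z (range \<sigma>)"
  have pos: "0 < sum a {1..\<nu> N}" for N using waterman_sum_pos[OF a] \<nu>(1)[of N] by simp
  have h: "0 < h N" for N using pos by (simp add: h_def)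
  have fin: "finite (even_reciprocals n)" for n by (simp add: even_reciprocals_def)
  have Ksub: "K \<subseteq> wspace a"
    using spikes_in_wspace[OF a] fin h by (auto simp: K_def \<sigma>_def z_def less_imp_le)
  have K_bfun: "K \<subseteq> bfun_space" using Ksub wspace_subset_bfun_space[OF a] by blast
  \<comment> \<open>The variation bound for \<open>n\<close> spikes involves \<open>2 * n\<close>
    terms; the second half of them sums to no more than the first.\<close>
  have double: "sum a {1..2 * n} \<le> 2 * sum a {1..n}" for n
  proof -
    have "sum a {1..2 * n} = sum a {1..n} + sum a {n + 1..n + n}"
      unfolding mult_2 by (rule sum.ub_add_nat) simp
    also have "sum a {n + 1..n + n} \<le> sum a {1..n}"
      using sum_antimono_le_initial[OF waterman_antimono[OF a], of "{n + 1..n + n}"] by simp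
    finally show ?thesis by simp
  qed
  have "wnorm a x \<le> 2" if "x \<in> K" for x
  proof -
    have "wvar a x \<le> ennreal 2"
      using that unfolding K_def
    proof (elim insertE rangeE)
      fix N assume x: "x = \<sigma> N"
      have "wvar a x \<le> ennreal (h N * sum a {1..2 * \<nu> N})"
        using wvar_spikes_le[OF a fin[of "\<nu> N"], of "h N"] h[of N]
        by (simp add: x \<sigma>_def card_even_reciprocals)
      also have "\<dots> \<le> ennreal 2"
        using double[of "\<nu> N"] pos[of N] by (intro ennreal_leI) (simp add: h_def divide_le_eq)
      finally show ?thesis .
    next
      assume "x = z"
      then have "wvar a x \<le> ennreal 0" using wvar_spikes_le[OF a, of "{}" 0] by (simp add: z_def)
      then show ?thesis by simp
    qed
    then have "enn2real (wvar a x) \<le> enn2real (ennreal 2)" by (intro enn2real_mono) auto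
    \<comment> \<open>No spike sits at \<open>0\<close>, so the norm is just the variation.\<close>
    moreover have "x 0 = 0"
      using that by (auto simp: K_def \<sigma>_def z_def spikes_def even_reciprocals_def)
    ultimately show ?thesis by (simp add: wnorm_def)
  qed
  then have bdd: "\<forall>x\<in>K. wnorm a x \<le> 2" by blast
  have h0: "h \<longlonglongrightarrow> 0"
  proof (rule tendsto_sandwich[of "\<lambda>_. 0"])
    show "\<forall>\<^sub>F N in sequentially. h N \<le> inverse (sum a {1..Suc N})"
      unfolding h_def inverse_eq_divide using pos \<nu>(1) le_trans[OF _ \<nu>(1)]
      by (intro always_eventually allI divide_left_mono mult_pos_pos waterman_sum_mono[OF a]
            waterman_sum_pos[OF a]) auto
    have "filterlim (\<lambda>N. sum a {1..Suc N}) at_top sequentially"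
      by (rule filterlim_compose[OF waterman_sum_at_top[OF a] filterlim_Suc])
    then show "(\<lambda>N. inverse (sum a {1..Suc N})) \<longlonglongrightarrow> 0"
      by (rule tendsto_inverse_0_at_top)
  qed (use h in \<open>auto intro!: always_eventually less_imp_le\<close>)
  have \<sigma>_abs: "\<bar>\<sigma> N t\<bar> \<le> h N" if "t \<in> {0..1}" for N t
    using that h[of N] by (simp add: \<sigma>_def spikes_def)
  have z0: "z t = 0" if "t \<in> {0..1}" for t
    using that by (simp add: z_def spikes_def)
  have "limitin S.mtopology \<sigma> z sequentially"
    unfolding S.limit_metric_sequentially
  proof (intro conjI allI impI)
    show "z \<in> bfun_space" using K_bfun by (simp add: K_def)
    fix \<epsilon>' :: real assume "0 < \<epsilon>'"
    then obtain M where M: "\<And>N. M \<le> N \<Longrightarrow> h N < \<epsilon>'"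
      using LIMSEQ_D[OF h0] by fastforce
    have "\<sigma> N \<in> bfun_space \<and> sup_norm (\<sigma> N - z) < \<epsilon>'" if "M \<le> N" for N
    proof -
      have "sup_norm (\<sigma> N - z) \<le> h N" by (rule sup_norm_le) (simp add: \<sigma>_abs z0)
      then show ?thesis using M[OF that] K_bfun by (auto simp: K_def)
    qed
    then show "\<exists>M. \<forall>N\<ge>M. \<sigma> N \<in> bfun_space \<and> sup_norm (\<sigma> N - z) < \<epsilon>'" by blast
  qed
  then have "compactin S.mtopology K"
    unfolding K_def using K_bfun by (intro compactin_sequence_with_limit) (auto simp: K_def)
  moreover from this have "S.mtopology closure_of K = K"
    by (intro closure_of_closedin compactin_imp_closedin S.Hausdorff_space_mtopology)
  ultimately have "relatively_compact_in (norm_topology bfun_space sup_norm) K"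
    using K_bfun by (simp add: relatively_compact_in_def norm_topology_def)
  then have "relatively_compact_in (norm_topology (wspace b) (wnorm b)) K"
    by (rule compactness[OF Ksub bdd])
  then have Kb: "K \<subseteq> wspace b" and cpt: "compactin W.mtopology (W.mtopology closure_of K)"
    by (auto simp: relatively_compact_in_def norm_topology_def)
  have "range \<sigma> \<subseteq> W.mtopology closure_of K"
    using closure_of_subset[of K W.mtopology] Kb by (auto simp: K_def)
  then obtain l r where r: "strict_mono r"
    and conv: "limitin W.mtopology (\<sigma> \<circ> r) l sequentially"
    using cpt unfolding W.compactin_sequentially by blast
  then have l: "l \<in> wspace b"
    and dist: "\<And>e. 0 < e \<Longrightarrow> \<exists>N. \<forall>n\<ge>N. wnorm b ((\<sigma> \<circ> r) n - l) < e"
    unfolding W.limit_metric_sequentially by blast+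
  have \<sigma>b: "\<sigma> N \<in> wspace b" for N using Kb by (auto simp: K_def)
  have wn0: "(\<lambda>n. wnorm b ((\<sigma> \<circ> r) n - l)) \<longlonglongrightarrow> 0"
    using dist by (intro LIMSEQ_I) (simp add: wnorm_def)
  have l0: "l t = 0" if t: "t \<in> {0..1}" for t
  proof -
    have lim0: "(\<lambda>n. (1 + 1 / b 1) * wnorm b ((\<sigma> \<circ> r) n - l)) \<longlonglongrightarrow> 0"
      by (rule tendsto_mult_right_zero[OF wn0])
    have bound: "norm ((\<sigma> \<circ> r) n t - l t) \<le> (1 + 1 / b 1) * wnorm b ((\<sigma> \<circ> r) n - l)" for n
      using abs_le_wnorm[OF b wvar_minus_finite[OF b \<sigma>b l] t, of "r n"] by simp
    have "(\<lambda>n. (\<sigma> \<circ> r) n t - l t) \<longlonglongrightarrow> 0"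
      by (rule Lim_null_comparison[OF always_eventually[OF allI[OF bound]] lim0])
    then have "(\<lambda>n. (\<sigma> \<circ> r) n t) \<longlonglongrightarrow> l t" by (rule LIM_zero_cancel)
    moreover have "(\<lambda>n. (h \<circ> r) n) \<longlonglongrightarrow> 0" using LIMSEQ_subseq_LIMSEQ[OF h0 r] by (simp add: comp_def)
    then have "(\<lambda>n. (\<sigma> \<circ> r) n t) \<longlonglongrightarrow> 0"
      by (rule Lim_null_comparison[rotated]) (use \<sigma>_abs[OF t] in auto)
    ultimately show ?thesis by (rule LIMSEQ_unique)
  qed
  obtain N where N: "wnorm b (\<sigma> (r N) - l) < \<epsilon>" using dist[OF \<epsilon>] by auto
  have "ennreal \<epsilon> \<le> ennreal (h (r N) * sum b {1..\<nu> (r N)})"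
    using \<nu>(2)[of "r N"] by (intro ennreal_leI) (simp add: h_def)
  also have "\<dots> \<le> wvar b (\<sigma> (r N))"
    unfolding \<sigma>_def using h[of "r N"] by (intro wvar_spikes_even_reciprocals_ge[OF b]) simp
  \<comment> \<open>Subtracting \<open>l\<close> changes nothing on \<open>[0,1]\<close>, and the
    variation sees only values there.\<close>
  also have "\<dots> = wvar b (\<sigma> (r N) - l)"
    by (rule wvar_cong) (simp add: l0)
  finally have "enn2real (ennreal \<epsilon>) \<le> enn2real (wvar b (\<sigma> (r N) - l))"
    using wvar_minus_finite[OF b \<sigma>b l] by (intro enn2real_mono) auto
  then have "\<epsilon> \<le> wnorm b (\<sigma> (r N) - l)" using \<epsilon> by (simp add: wnorm_def)
  then show False using N by simp
qed

section \<open>Katetov reductions of summable ideals\<close>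

lemma index_seq_mono:
  assumes "index_seq m" "1 \<le> i" "i \<le> j"
  shows "m i \<le> m j"
  using assms strict_mono_on_leD[of "{1..}" m i j] by (simp add: index_seq_def)

lemma block_scale_nonneg:
  assumes "index_seq m" "0 \<le> b i"
  shows "0 \<le> block_scale m b i"
proof (cases "i < m 1")
  case False
  then obtain k where "1 \<le> k" "m k \<le> i" "i < m (Suc k)"
    using block_exists[OF assms(1)] by (meson not_less)
  then show ?thesis using block_scale_eq[OF assms(1)] assms(2) by simp
qed (use assms in \<open>simp add: block_scale_def\<close>)

lemma block_scale_ge:
  assumes m: "index_seq m" and k: "1 \<le> k" "m k \<le> i" and b: "0 \<le> b i"
  shows "real k * b i \<le> block_scale m b i"
proof -
  have "m 1 \<le> i" using index_seq_mono[OF m _ k(1)] k by simp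
  then obtain j where j: "1 \<le> j" "m j \<le> i" "i < m (Suc j)"
    using block_exists[OF m] by blast
  have "k \<le> j"
  proof (rule ccontr)
    assume "\<not> k \<le> j"
    then have "m (Suc j) \<le> m k" using index_seq_mono[OF m, of "Suc j" k] by simp
    then show False using j k by simp
  qed
  then show ?thesis using block_scale_eq[OF m j] b by (simp add: mult_right_mono)
qed

lemma block_scale_le:
  assumes m: "index_seq m" and k: "1 \<le> k" "i < m (Suc k)" and b: "0 \<le> b i"
  shows "block_scale m b i \<le> real k * b i"
proof (cases "i < m 1")
  case True
  have "1 * b i \<le> real k * b i" using k b by (intro mult_right_mono) auto
  then show ?thesis using True by (simp add: block_scale_def)
next
  case False
  then obtain j where j: "1 \<le> j" "m j \<le> i" "i < m (Suc j)"
    using block_exists[OF m] by (meson not_less)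
  have "j \<le> k"
  proof (rule ccontr)
    assume "\<not> j \<le> k"
    then have "m (Suc k) \<le> m j" using index_seq_mono[OF m, of "Suc k" j] by simp
    then show False using j k by simp
  qed
  then show ?thesis using block_scale_eq[OF m j] b by (simp add: mult_right_mono)
qed

section \<open>From the ratio condition to a Katetov reduction\<close>

lemma waterman_sum_le_add:
  assumes a: "waterman a" and j: "1 \<le> j"
  shows "sum a {1..n} \<le> sum a {1..j} + real n * a j"
proof (cases "n \<le> j")
  case True
  have "0 \<le> real n * a j" using waterman_pos[OF a j] by simp
  then show ?thesis using waterman_sum_mono[OF a True] by simp
next
  case False
  then obtain p where p: "n = j + p" by (metis le_add_diff_inverse nat_le_linear)
  have "sum a {1..n} = sum a {1..j} + sum a {j + 1..j + p}"
    unfolding p by (rule sum.ub_add_nat) simp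
  also have "sum a {j + 1..j + p} \<le> real (card {j + 1..j + p}) * a j"
    using j by (intro sum_bounded_above waterman_le[OF a]) auto
  also have "\<dots> \<le> real n * a j"
    using waterman_pos[OF a j] p by (intro mult_right_mono) auto
  finally show ?thesis by simp
qed

lemma waterman_mult_le_sum:
  assumes b: "waterman b"
  shows "real n * b n \<le> sum b {1..n}"
  using sum_bounded_below[of "{1..n}" "b n" b] waterman_le[OF b] by simp

text \<open>Otherwise \<open>n * a j\<close> is at most \<kappa> times the partial sum of
  \<open>b\<close>. As \<open>a j\<close> is at most the sum of \<open>a\<close> before
  \<open>j\<close>, the partial sum of \<open>a\<close> up to \<open>n\<close> would be less than
  three times \<kappa> times that of \<open>b\<close>, against the factor \<open>4\<close>.\<close>

lemma greedy_jump_le: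
  assumes a: "waterman a" and b: "waterman b" and j: "2 \<le> j" and n: "1 \<le> n"
    and small: "4 * \<kappa> * sum b {1..n} \<le> sum a {1..n}" and \<kappa>: "1 \<le> \<kappa>"
    and large: "sum a {1..j - 1} < \<kappa> * sum b {1..n}"
  shows "\<kappa> * b n \<le> a j"
proof (rule ccontr)
  assume "\<not> ?thesis"
  then have "real n * a j \<le> real n * (\<kappa> * b n)" by (intro mult_left_mono) auto
  also have "\<dots> = \<kappa> * (real n * b n)" by simp
  also have "\<dots> \<le> \<kappa> * sum b {1..n}"
    using \<kappa> waterman_mult_le_sum[OF b] by (intro mult_left_mono) auto
  finally have "sum a {1..n} \<le> sum a {1..j} + \<kappa> * sum b {1..n}"
    using waterman_sum_le_add[OF a, of j n] j by simp
  moreover have "sum a {1..j} = sum a {1..j - 1} + a j"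
    using j by (cases j) auto
  moreover have "a j \<le> sum a {1..j - 1}"
  proof -
    have "a j \<le> a 1" using waterman_le[OF a] j by simp
    also have "\<dots> = sum a {1..1}" by simp
    also have "\<dots> \<le> sum a {1..j - 1}" using j by (intro waterman_sum_mono[OF a]) simp
    finally show ?thesis .
  qed
  moreover have "0 < sum a {1..j - 1}" using j by (intro waterman_sum_pos[OF a]) simp
  ultimately show False using small large by (simp add: mult.assoc)
qed

text \<open>
  The intervals \<open>(C\<^sub>n\<^sub>-\<^sub>1, C\<^sub>n]\<close> are packed into the intervals \<open>(A\<^sub>j\<^sub>-\<^sub>1, A\<^sub>j]\<close>, where \<open>A\<close> and \<open>C\<close>
  are the partial sums of \<open>a\<close> and \<open>c = B\<^sup>M\<close>: then \<open>n\<close> is sent to the \<open>j\<close> with \<open>C\<^sub>n\<close> in the latter.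
  The preimage of \<open>j\<close> has \<open>c\<close>-weight at most \<open>a\<^sub>j\<close> plus the first jump, itself at most \<open>a\<^sub>j\<close>.
\<close>

lemma katetov_le_of_sum_ratio:
  assumes a: "waterman a" and b: "waterman b"
    and lim: "(\<lambda>n. sum b {1..n} / sum a {1..n}) \<longlonglongrightarrow> 0"
  shows "\<exists>m. index_seq m \<and> katetov_le (summable_ideal a) (summable_ideal (block_scale m b))"
proof -
  have "\<exists>N. \<forall>n\<ge>N. 4 * real (Suc k) * sum b {1..n} \<le> sum a {1..n}" for k
  proof -
    have "eventually (\<lambda>n. sum b {1..n} / sum a {1..n} < 1 / (4 * real (Suc k))) sequentially"
      by (rule order_tendstoD(2)[OF lim]) simp
    moreover have "eventually (\<lambda>n::nat. 1 \<le> n) sequentially" by (rule eventually_ge_at_top)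
    ultimately have "eventually (\<lambda>n. 4 * real (Suc k) * sum b {1..n} \<le> sum a {1..n}) sequentially"
    proof eventually_elim
      case (elim n)
      then show ?case using waterman_sum_pos[OF a elim(2)] by (simp add: field_simps)
    qed
    then show ?thesis by (simp add: eventually_sequentially)
  qed
  then obtain g where g: "\<And>k n. g k \<le> n \<Longrightarrow> 4 * real (Suc k) * sum b {1..n} \<le> sum a {1..n}"
    by metis
  \<comment> \<open>\<open>g k\<close> serves the factor \<open>Suc k\<close> and lies below
    \<open>m (Suc k)\<close>, so from \<open>m k\<close> on the smallness holds with factor
    \<open>k\<close>.\<close>
  define m where "m = (\<lambda>k. \<Sum>i<k. Suc (g i))"
  have m_Suc: "m (Suc k) = m k + Suc (g k)" for k by (simp add: m_def)
  have m_strict: "strict_mono m" by (rule strict_mono_Suc_iff[THEN iffD2]) (simp add: m_Suc)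
  have m: "index_seq m"
    unfolding index_seq_def
  proof
    show "\<forall>k\<ge>1. 1 \<le> m k"
    proof (intro allI impI)
      fix k :: nat assume "1 \<le> k"
      then show "1 \<le> m k" by (cases k) (auto simp: m_Suc)
    qed
    show "strict_mono_on {1..} m" using m_strict by (auto simp: strict_mono_on_def strict_mono_def)
  qed
  have small: "4 * real k * sum b {1..n} \<le> sum a {1..n}" if k: "1 \<le> k" "m k \<le> n" for k n
  proof -
    obtain k' where "k = Suc k'" using k(1) by (cases k) auto
    then show ?thesis using g[of k' n] k(2) by (simp add: m_Suc)
  qed
  have b0: "0 \<le> b n" if "1 \<le> n" for n using waterman_pos[OF b that] by simp
  have a0: "0 \<le> a n" if "1 \<le> n" for n using waterman_pos[OF a that] by simp
  define c where "c = block_scale m b"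
  define C where "C = (\<lambda>n. sum c {1..n})"
  have c0: "0 \<le> c n" if "1 \<le> n" for n
    unfolding c_def using m b0[OF that] by (rule block_scale_nonneg)
  have C_le: "C n \<le> real k * sum b {1..n}" if "1 \<le> k" "n < m (Suc k)" for k n
    unfolding C_def c_def sum_distrib_left
    using that b0 by (intro sum_mono block_scale_le[OF m]) auto
  have C_mono: "C i \<le> C j" if "i \<le> j" for i j
    unfolding C_def using that c0 by (intro sum_mono2) auto
  \<comment> \<open>The clause \<open>1 \<le> j\<close> keeps the values in the index set.
    Minimality yields the lower bound \<open>f_less\<close> once the value is at least
    \<open>2\<close>.\<close>
  define f where "f = (\<lambda>n. LEAST j. 1 \<le> j \<and> C n \<le> sum a {1..j})"
  have ex: "\<exists>j. 1 \<le> j \<and> C n \<le> sum a {1..j}" for n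
    using waterman_sum_at_top[OF a] unfolding filterlim_at_top eventually_sequentially
    by (meson nat_le_linear order_refl)
  have f: "1 \<le> f n" "C n \<le> sum a {1..f n}" for n
    using LeastI_ex[OF ex[of n]] by (auto simp: f_def)
  have f_less: "sum a {1..f n - 1} < C n" if "2 \<le> f n" for n
    using not_less_Least[of "f n - 1" "\<lambda>j. 1 \<le> j \<and> C n \<le> sum a {1..j}"] that
    by (auto simp: f_def not_le)
  \<comment> \<open>With \<open>p\<close> and \<open>q\<close> the least and greatest elements of
    \<open>F\<close>, the weight is at most \<open>C q - C (p - 1)\<close>. Restricting to
    \<open>{m 1..}\<close> makes every \<open>p\<close> lie in a block, where the jump estimate is
    available.\<close>
  have fibre: "sum c F \<le> 2 * a j"
    if F: "finite F" "F \<subseteq> {m 1..}" "\<And>n. n \<in> F \<Longrightarrow> f n = j" "1 \<le> j" for F j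
  proof (cases "F = {}")
    case False
    define p where "p = Min F"
    define q where "q = Max F"
    have p: "p \<in> F" and q: "q \<in> F" using F(1) False by (auto simp: p_def q_def)
    have "1 \<le> m 1" using m by (simp add: index_seq_def)
    then have p1: "1 \<le> p" "m 1 \<le> p" using p F(2) by auto
    have "p \<le> q" using p F(1) by (simp add: q_def)
    have Cq: "C q \<le> sum a {1..j}" using f(2)[of q] F(3)[OF q] by simp
    have "F \<subseteq> {p..q}" using F(1) by (auto simp: p_def q_def)
    then have "sum c F \<le> sum c {p..q}" using p1 c0 by (intro sum_mono2) auto
    also have "\<dots> = C q - C (p - 1)"
    proof -
      obtain p' where p': "p = p' + 1" using p1(1) by (cases p) auto
      obtain r where r: "q = p' + r" using \<open>p \<le> q\<close> p' by (auto simp: nat_le_iff_add)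
      show ?thesis unfolding C_def p' r using sum.ub_add_nat[of 1 p' c r] by simp
    qed
    also have "\<dots> \<le> 2 * a j"
    proof (cases "j = 1")
      case True
      then show ?thesis using Cq C_mono[of 0 "p - 1"] a0[of 1] by (simp add: C_def)
    next
      case False
      then have j: "2 \<le> j" "f p = j" using F(3)[OF p] F(4) by auto
      obtain k where k: "1 \<le> k" "m k \<le> p" "p < m (Suc k)"
        using block_exists[OF m p1(2)] by blast
      have lt: "sum a {1..j - 1} < C p" using f_less[of p] j by simp
      also have "C p \<le> real k * sum b {1..p}" by (rule C_le[OF k(1,3)])
      finally have "real k * b p \<le> a j"
        using k by (intro greedy_jump_le[OF a b j(1) p1(1) small[OF k(1,2)]]) auto
      then have "c p \<le> a j" using block_scale_eq[OF m k] by (simp add: c_def)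
      moreover have "C p = C (p - 1) + c p"
        using p1(1) by (cases p) (auto simp: C_def)
      moreover have "sum a {1..j} = sum a {1..j - 1} + a j"
        using j(1) by (cases j) auto
      ultimately show ?thesis using lt Cq by linarith
    qed
    finally show ?thesis .
  qed (use a0 that in simp)
  have "f -` S \<inter> {1..} \<in> summable_ideal c" if S: "S \<in> summable_ideal a" for S
  proof -
    have S1: "S \<subseteq> {1..}" and sum: "a summable_on S" using S by (auto simp: summable_ideal_def)
    \<comment> \<open>Indices below \<open>m 1\<close> cost a constant; the others are grouped by
      fibres over points of \<open>S\<close>.\<close>
    have "sum c F \<le> C (m 1) + 2 * infsum a S" if F: "finite F" "F \<subseteq> f -` S \<inter> {1..}" for F
    proof -
      define G where "G = F \<inter> {m 1..}"
      have "sum c F = sum c (F - {m 1..}) + sum c G"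
        unfolding G_def using F(1) by (metis add.commute sum.Int_Diff)
      also have "sum c (F - {m 1..}) \<le> C (m 1)"
        unfolding C_def using F c0 by (intro sum_mono2) auto
      also have "sum c G = (\<Sum>j\<in>f ` G. sum c {n \<in> G. f n = j})"
        using F(1) by (intro sum.image_gen) (simp add: G_def)
      also have "\<dots> \<le> (\<Sum>j\<in>f ` G. 2 * a j)"
        using F f(1) by (intro sum_mono fibre) (auto simp: G_def)
      also have "\<dots> = 2 * sum a (f ` G)" by (simp add: sum_distrib_left)
      also have "sum a (f ` G) \<le> infsum a S"
        using F S1 a0 by (intro finite_sum_le_infsum sum) (auto simp: G_def)
      finally show ?thesis by simp
    qed
    then have "c summable_on (f -` S \<inter> {1..})"
      using c0 by (intro nonneg_bdd_above_summable_on) (auto intro!: bdd_aboveI)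
    then show ?thesis by (simp add: summable_ideal_def)
  qed
  then have "katetov_le (summable_ideal a) (summable_ideal (block_scale m b))"
    unfolding katetov_le_def c_def[symmetric] using f(1) by (intro bexI[of _ f]) auto
  then show ?thesis using m by blast
qed

section \<open>From a Katetov reduction to the ratio condition\<close>

text \<open>
  Otherwise there are successive finite blocks on which \<open>d\<close> sums to at least \<open>1\<close> and \<open>a\<close> to at most
  \<open>2 / 2\<^sup>i\<close>; the union of the blocks contradicts the hypothesis.
\<close>

lemma sum_le_affine_of_summable_imp_bounded:
  fixes a d :: "nat \<Rightarrow> real"
  assumes a_lim: "a \<longlonglongrightarrow> 0" and a0: "\<And>n. 1 \<le> n \<Longrightarrow> 0 \<le> a n" and d0: "\<And>n. 1 \<le> n \<Longrightarrow> 0 \<le> d n"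
    and dom: "\<And>C. C \<subseteq> {1..} \<Longrightarrow> a summable_on C \<Longrightarrow> \<exists>D. \<forall>F. finite F \<and> F \<subseteq> C \<longrightarrow> sum d F \<le> D"
  shows "\<exists>L\<ge>0. \<exists>D. \<forall>F. finite F \<and> F \<subseteq> {1..} \<longrightarrow> sum d F \<le> D + L * sum a F"
proof (rule ccontr)
  assume "\<not> ?thesis"
  then have large: "\<exists>F. finite F \<and> F \<subseteq> {1..} \<and> D + L * sum a F < sum d F" if "0 \<le> L" for L D
    using that by (meson not_le)
  have "\<exists>H. finite H \<and> H \<subseteq> {Suc N..} \<and> 1 \<le> sum d H \<and> sum a H \<le> 2 * (1/2) ^ i" for i N
  proof -
    obtain N0 where N0: "\<And>n. N0 \<le> n \<Longrightarrow> \<bar>a n\<bar> < (1/2) ^ i"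
      using LIMSEQ_D[OF a_lim, of "(1/2) ^ i"] by auto
    define N' where "N' = max N N0"
    \<comment> \<open>The excess \<open>1 + sum d {1..N'}\<close> survives discarding the indices up
      to \<open>N'\<close> and those with \<open>d n < 2 ^ i * a n\<close>: what remains still has
      \<open>d\<close>-sum at least \<open>1\<close>.\<close>
    obtain F where F: "finite F" "F \<subseteq> {1..}"
      and Fd: "1 + sum d {1..N'} + 2 ^ i * sum a F < sum d F"
      using large[of "2 ^ i" "1 + sum d {1..N'}"] by auto
    define F' where "F' = {n \<in> F. N' < n \<and> 2 ^ i * a n \<le> d n}"
    have "sum d F \<le> sum d (F' \<union> {1..N'}) + sum d (F - F' - {1..N'})"
      using F d0 by (subst sum.union_disjoint[symmetric]) (auto intro!: sum_mono2 simp: F'_def)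
    moreover have "sum d (F' \<union> {1..N'}) = sum d F' + sum d {1..N'}"
      using F by (intro sum.union_disjoint) (auto simp: F'_def)
    moreover have "sum d (F - F' - {1..N'}) \<le> (\<Sum>n\<in>F - F' - {1..N'}. 2 ^ i * a n)"
      using F by (intro sum_mono) (force simp: F'_def)
    moreover have "\<dots> \<le> (\<Sum>n\<in>F. 2 ^ i * a n)"
      using F a0 by (intro sum_mono2) auto
    ultimately have "1 \<le> sum d F'" using Fd by (simp add: sum_distrib_left)
    moreover have "finite F'" using F by (simp add: F'_def)
    \<comment> \<open>By minimality, \<open>H\<close> without one point \<open>h\<close> has
      \<open>d\<close>-sum below \<open>1\<close>, hence \<open>a\<close>-sum at most
      \<open>(1/2) ^ i\<close>. The point \<open>h\<close> lies beyond \<open>N0\<close> and adds at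
      most as much again.\<close>
    ultimately obtain H where H: "H \<subseteq> F'" "1 \<le> sum d H"
      and minimal: "\<And>G. G \<subset> H \<Longrightarrow> \<not> 1 \<le> sum d G"
      using finite_has_minimal2[of "{G. G \<subseteq> F' \<and> 1 \<le> sum d G}" F']
      by (auto simp: finite_Collect_subsets) (metis order.strict_iff_order order_trans)
    have finH: "finite H" using H(1) \<open>finite F'\<close> by (rule finite_subset)
    have "H \<noteq> {}" using H(2) by auto
    then obtain h where h: "h \<in> H" by blast
    have "2 ^ i * sum a (H - {h}) \<le> sum d (H - {h})"
      unfolding sum_distrib_left using H(1) by (intro sum_mono) (auto simp: F'_def)
    also have "\<dots> < 1" using minimal[of "H - {h}"] h by force
    finally have "sum a (H - {h}) \<le> (1/2) ^ i" by (simp add: field_simps power_divide)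
    moreover have "a h \<le> (1/2) ^ i"
      using N0[of h] h H(1) by (force simp: F'_def N'_def)
    moreover have "sum a H = a h + sum a (H - {h})" by (rule sum.remove[OF finH h])
    ultimately have "sum a H \<le> 2 * (1/2) ^ i" by simp
    moreover have "H \<subseteq> {Suc N..}" using H(1) by (auto simp: F'_def N'_def)
    ultimately show ?thesis using finH H(2) by blast
  qed
  then obtain H where "\<forall>i N. finite (H i N) \<and> H i N \<subseteq> {Suc N..} \<and>
      1 \<le> sum d (H i N) \<and> sum a (H i N) \<le> 2 * (1/2) ^ i"
    by (atomize_elim, intro choice allI) blast
  then have H: "\<And>i N. finite (H i N)" "\<And>i N. H i N \<subseteq> {Suc N..}"
    "\<And>i N. 1 \<le> sum d (H i N)" "\<And>i N. sum a (H i N) \<le> 2 * (1/2) ^ i"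
    by blast+
  \<comment> \<open>Each threshold is the end of the previous block, which makes the blocks
    \<open>G i\<close> successive.\<close>
  define M where "M = rec_nat 0 (\<lambda>i N. Max (insert N (H i N)))"
  define G where "G = (\<lambda>i. H i (M i))"
  have M_Suc: "M (Suc i) = Max (insert (M i) (G i))" for i by (simp add: M_def G_def)
  have M_mono: "M i \<le> M j" if "i \<le> j" for i j
    by (rule lift_Suc_mono_le[OF _ that]) (simp add: M_Suc G_def H(1))
  have G_sub: "G i \<subseteq> {Suc (M i)..M (Suc i)}" for i
    using H(1,2)[of i "M i"] by (auto simp: M_Suc G_def)
  have G_disj: "G i \<inter> G j = {}" if "i \<noteq> j" for i j
    using that
  proof (induction i j rule: linorder_wlog)
    case (le i j)
    then have "M (Suc i) \<le> M j" by (intro M_mono) simp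
    then show ?case using G_sub[of i] G_sub[of j] by force
  qed blast
  have sum_blocks: "sum u (\<Union>i\<in>I. G i) = (\<Sum>i\<in>I. sum u (G i))" if "finite I" for I and u :: "nat \<Rightarrow> real"
    using that G_disj H(1) by (intro sum.UNION_disjoint) (auto simp: G_def)
  define C where "C = (\<Union>i. G i)"
  have C1: "C \<subseteq> {1..}" using G_sub by (force simp: C_def)
  have "sum a F \<le> 4" if F: "finite F" "F \<subseteq> C" for F
  proof -
    \<comment> \<open>Only finitely many blocks are needed to cover \<open>F\<close>, so a geometric
      series bounds its \<open>a\<close>-sum by \<open>4\<close>.\<close>
    obtain g where g: "\<And>n. n \<in> F \<Longrightarrow> n \<in> G (g n)"
      using F(2) unfolding C_def by (metis UN_E subsetD)
    have sub: "F \<subseteq> (\<Union>i\<in>g ` F. G i)" using g by auto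
    have "sum a F \<le> sum a (\<Union>i\<in>g ` F. G i)"
      using sub F(1) C1 a0 H(1) by (intro sum_mono2) (auto simp: G_def C_def)
    also have "\<dots> = (\<Sum>i\<in>g ` F. sum a (G i))" using F(1) by (intro sum_blocks) simp
    also have "\<dots> \<le> (\<Sum>i\<in>g ` F. 2 * (1/2) ^ i)" by (intro sum_mono) (simp add: G_def H(4))
    also have "\<dots> = 2 * (\<Sum>i\<in>g ` F. (1/2) ^ i)" by (simp add: sum_distrib_left)
    also have "(\<Sum>i\<in>g ` F. (1/2) ^ i) \<le> (\<Sum>i. (1/2::real) ^ i)"
      using F(1) by (intro sum_le_suminf) auto
    also have "\<dots> = 2" by (subst suminf_geometric) auto
    finally show ?thesis by simp
  qed
  then have "a summable_on C"
    using a0 C1 by (intro nonneg_bdd_above_summable_on) (auto intro!: bdd_aboveI[of _ 4])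
  then obtain D where D: "\<And>F. finite F \<Longrightarrow> F \<subseteq> C \<Longrightarrow> sum d F \<le> D"
    using dom[OF C1] by blast
  obtain n :: nat where n: "D < real n" using reals_Archimedean2 by blast
  have "real n = (\<Sum>i<n. 1)" by simp
  also have "\<dots> \<le> (\<Sum>i<n. sum d (G i))" by (intro sum_mono) (simp add: G_def H(3))
  also have "\<dots> = sum d (\<Union>i<n. G i)" by (simp add: sum_blocks)
  also have "\<dots> \<le> D" by (rule D) (auto simp: G_def H(1) C_def)
  finally show False using n by simp
qed

text \<open>The weights \<open>c\<close> are pushed forward along \<open>f\<close>:
  \<open>d j\<close> is the weight of the fibre over \<open>j\<close>. The reduction property is
  then the domination hypothesis of the preceding lemma.\<close>

lemma katetov_le_summable_idealE:
  fixes a c :: "nat \<Rightarrow> real"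
  assumes K: "katetov_le (summable_ideal a) (summable_ideal c)" and a_lim: "a \<longlonglongrightarrow> 0"
    and a0: "\<And>n. 1 \<le> n \<Longrightarrow> 0 \<le> a n" and c0: "\<And>n. 1 \<le> n \<Longrightarrow> 0 \<le> c n"
    and anti: "antimono_on {1..} a"
  obtains L D where "0 \<le> L" "\<And>n. sum c {1..n} \<le> D + L * sum a {1..n}"
proof -
  obtain f where f: "\<And>n. 1 \<le> n \<Longrightarrow> 1 \<le> f n"
    and fS: "\<And>S. S \<in> summable_ideal a \<Longrightarrow> f -` S \<inter> {1..} \<in> summable_ideal c"
    using K unfolding katetov_le_def by (auto simp: Pi_iff)
  define P where "P = (\<lambda>S. f -` S \<inter> {1..})"
  have sumP: "c summable_on P S" if "S \<subseteq> {1..}" "a summable_on S" for S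
    using fS[of S] that by (simp add: summable_ideal_def P_def)
  \<comment> \<open>Finite sets lie in the ideal of \<open>a\<close>, so fibres have finite weight
    and \<open>infsum\<close> is not a default value.\<close>
  have sumP_fin: "c summable_on P S" if "S \<subseteq> {1..}" "finite S" for S
    by (rule sumP) (use that in auto)
  define d where "d = (\<lambda>j. infsum c (P {j}))"
  have sum_d: "infsum c (P F) = sum d F" if "finite F" "F \<subseteq> {1..}" for F
    using that
  proof (induction F rule: finite_induct)
    case empty
    then show ?case by (simp add: P_def)
  next
    case (insert j F)
    have "P (insert j F) = P {j} \<union> P F" by (auto simp: P_def)
    moreover have "infsum c (P {j} \<union> P F) = infsum c (P {j}) + infsum c (P F)"
      using insert by (intro infsum_Un_disjoint sumP_fin) (auto simp: P_def)
    ultimately show ?case using insert by (simp add: d_def)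
  qed
  have "\<exists>L\<ge>0. \<exists>D. \<forall>F. finite F \<and> F \<subseteq> {1..} \<longrightarrow> sum d F \<le> D + L * sum a F"
  proof (rule sum_le_affine_of_summable_imp_bounded[OF a_lim a0])
    show "0 \<le> d n" for n unfolding d_def using c0 by (intro infsum_nonneg) (auto simp: P_def)
    fix C assume C: "C \<subseteq> {1..}" "a summable_on C"
    have "sum d F \<le> infsum c (P C)" if "finite F" "F \<subseteq> C" for F
    proof -
      have "F \<subseteq> {1..}" using that C by blast
      then have "sum d F = infsum c (P F)" using sum_d that by simp
      also have "\<dots> \<le> infsum c (P C)"
        using that C c0 by (intro infsum_mono2 sumP sumP_fin) (auto simp: P_def)
      finally show ?thesis .
    qed
    then show "\<exists>D. \<forall>F. finite F \<and> F \<subseteq> C \<longrightarrow> sum d F \<le> D" by blast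
  qed
  then obtain L D where L: "0 \<le> L"
    and LD: "\<And>F. finite F \<Longrightarrow> F \<subseteq> {1..} \<Longrightarrow> sum d F \<le> D + L * sum a F"
    by blast
  have "sum c {1..n} \<le> D + L * sum a {1..n}" for n
  proof -
    \<comment> \<open>The preimage of \<open>F\<close> contains \<open>{1..n}\<close>, while
      \<open>F\<close> has at most \<open>n\<close> elements.\<close>
    define F where "F = f ` {1..n}"
    have F: "finite F" "F \<subseteq> {1..}" using f by (auto simp: F_def)
    have "sum c {1..n} \<le> infsum c (P F)"
      using c0 by (intro finite_sum_le_infsum sumP_fin F) (auto simp: P_def F_def)
    also have "\<dots> = sum d F" using F by (rule sum_d)
    also have "\<dots> \<le> D + L * sum a F" using F by (rule LD)
    also have "sum a F \<le> sum a {1..card F}" using anti F by (rule sum_antimono_le_initial)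
    also have "\<dots> \<le> sum a {1..n}"
      using a0 card_image_le[of "{1..n}" f] by (intro sum_mono2) (auto simp: F_def)
    finally show ?thesis using L by (simp add: mult_left_mono)
  qed
  then show thesis using L that by blast
qed

text \<open>If \<open>a\<close> tends to \<open>0\<close>, then beyond \<open>m k\<close> the terms
  of \<open>b\<close> are at most \<open>1 / k\<close> times the scaled ones, so the slope
  \<open>L\<close> shrinks to \<open>L / k\<close>. Otherwise \<open>a\<close> is bounded below and
  \<open>b\<close> tending to \<open>0\<close> is enough.\<close>

lemma sum_ratio_of_katetov_le:
  assumes a: "waterman a" and b: "proper_waterman b" and m: "index_seq m"
    and K: "katetov_le (summable_ideal a) (summable_ideal (block_scale m b))"
  shows "(\<lambda>n. sum b {1..n} / sum a {1..n}) \<longlonglongrightarrow> 0"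
proof -
  have bw: "waterman b" and b_lim: "b \<longlonglongrightarrow> 0" using b by (auto simp: proper_waterman_def)
  have a0: "0 \<le> a n" and b0: "0 \<le> b n" if "1 \<le> n" for n
    using waterman_pos[OF a that] waterman_pos[OF bw that] by auto
  \<comment> \<open>Finitely many terms go into the constant, so comparing \<open>b\<close> with
    \<open>u\<close> is only required eventually.\<close>
  have split: "sum b {1..n} \<le> sum b {1..N} + sum u {1..n}"
    if "\<And>i. N < i \<Longrightarrow> b i \<le> u i" "\<And>i. 1 \<le> i \<Longrightarrow> 0 \<le> u i" for N n and u :: "nat \<Rightarrow> real"
  proof -
    have "sum b {1..n} \<le> (\<Sum>i=1..n. (if i \<le> N then b i else 0) + u i)"
      using that by (intro sum_mono) auto
    also have "\<dots> = sum b {i \<in> {1..n}. i \<le> N} + sum u {1..n}"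
      by (subst sum.inter_filter) (simp_all add: sum.distrib)
    also have "sum b {i \<in> {1..n}. i \<le> N} \<le> sum b {1..N}"
      using b0 by (intro sum_mono2) auto
    finally show ?thesis by simp
  qed
  have "\<exists>\<beta>. \<forall>n. sum b {1..n} \<le> \<beta> + e * sum a {1..n}" if e: "0 < e" for e
  proof (cases "a \<longlonglongrightarrow> 0")
    case True
    define c where "c = block_scale m b"
    have c0: "0 \<le> c n" if "1 \<le> n" for n
      unfolding c_def using m b0[OF that] by (rule block_scale_nonneg)
    obtain L D where L: "0 \<le> L" and LD: "\<And>n. sum c {1..n} \<le> D + L * sum a {1..n}"
      using katetov_le_summable_idealE[OF K True a0 _ waterman_antimono[OF a]] c0
      unfolding c_def by blast
    obtain k :: nat where k: "L / e < real k" using reals_Archimedean2 by blast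
    moreover have "0 \<le> L / e" using L e by simp
    ultimately have k0: "0 < real k" by linarith
    have ke: "L / real k \<le> e" using k k0 e by (simp add: field_simps)
    have "sum b {1..n} \<le> (sum b {1..m k} + D / real k) + e * sum a {1..n}" for n
    proof -
      have "sum b {1..n} \<le> sum b {1..m k} + (\<Sum>i=1..n. c i / real k)"
      proof (rule split)
        fix i assume i: "m k < i"
        then have "real k * b i \<le> c i"
          unfolding c_def using k0 b0 by (intro block_scale_ge[OF m]) auto
        then show "b i \<le> c i / real k" using k0 by (simp add: field_simps)
      qed (use c0 in simp)
      also have "(\<Sum>i=1..n. c i / real k) = sum c {1..n} / real k" by (simp add: sum_divide_distrib)
      also have "\<dots> \<le> (D + L * sum a {1..n}) / real k"
        using LD[of n] k0 by (intro divide_right_mono) auto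
      also have "\<dots> = D / real k + L / real k * sum a {1..n}" by (simp add: add_divide_distrib)
      also have "L / real k * sum a {1..n} \<le> e * sum a {1..n}"
        using ke waterman_sum_nonneg[OF a] by (rule mult_right_mono)
      finally show ?thesis by simp
    qed
    then show ?thesis by blast
  next
    case False
    have "\<exists>\<delta>>0. \<forall>n\<ge>1. \<delta> \<le> a n"
    proof (rule ccontr)
      assume neg: "\<not> ?thesis"
      have "a \<longlonglongrightarrow> 0"
      proof (rule LIMSEQ_I)
        fix r :: real assume "0 < r"
        then obtain N where N: "1 \<le> N" "a N < r" using neg by (meson not_le)
        have "norm (a n - 0) < r" if "N \<le> n" for n
          using waterman_le[OF a N(1) that] a0[of n] N that by simp
        then show "\<exists>no. \<forall>n\<ge>no. norm (a n - 0) < r" by blast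
      qed
      then show False using False by simp
    qed
    then obtain \<delta> where \<delta>: "0 < \<delta>" "\<And>n. 1 \<le> n \<Longrightarrow> \<delta> \<le> a n" by blast
    obtain N where N: "\<And>n. N \<le> n \<Longrightarrow> \<bar>b n\<bar> < e * \<delta>"
      using LIMSEQ_D[OF b_lim, of "e * \<delta>"] e \<delta>(1) by auto
    have "sum b {1..n} \<le> sum b {1..N} + (\<Sum>i=1..n. e * a i)" for n
    proof (rule split)
      fix i assume i: "N < i"
      then have "e * \<delta> \<le> e * a i" using e \<delta>(2)[of i] by simp
      then show "b i \<le> e * a i" using N[of i] i by simp
    qed (use e a0 in simp)
    then show ?thesis unfolding sum_distrib_left by blast
  qed
  then show ?thesis unfolding sum_ratio_tendsto_0_iff[OF a bw] by blast
qed

theorem theorem3p10: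
  fixes a b :: "nat \<Rightarrow> real"
  assumes "waterman a" and "proper_waterman b"
  shows
    "((\<forall>K. K \<subseteq> wspace a \<and> (\<exists>c. \<forall>x\<in>K. wnorm a x \<le> c) \<and>
            relatively_compact_in (norm_topology bfun_space sup_norm) K \<longrightarrow>
            K \<subseteq> wspace b \<and> relatively_compact_in (norm_topology (wspace b) (wnorm b)) K)
      \<longleftrightarrow> (\<exists>m. index_seq m \<and> katetov_le (summable_ideal a) (summable_ideal (block_scale m b))))
     \<and>
     ((\<exists>m. index_seq m \<and> katetov_le (summable_ideal a) (summable_ideal (block_scale m b)))
      \<longleftrightarrow> (\<lambda>n. (\<Sum>k=1..n. b k) / (\<Sum>k=1..n. a k)) \<longlonglongrightarrow> 0)"
    (is "(?a \<longleftrightarrow> ?b) \<and> (?b \<longleftrightarrow> ?c)")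
proof -
  have b: "waterman b" using assms(2) by (simp add: proper_waterman_def)
  have "?a" if c: ?c
  proof (intro allI impI, elim conjE exE)
    fix K c assume K: "K \<subseteq> wspace a" "\<forall>x\<in>K. wnorm a x \<le> c"
      and cpt: "relatively_compact_in (norm_topology bfun_space sup_norm) K"
    \<comment> \<open>A bound \<open>c\<close> can be negative only if \<open>K\<close> is empty;
      the compactness lemma asks for a nonnegative one.\<close>
    have "wnorm a x \<le> max c 0" if "x \<in> K" for x using K(2) that by force
    then show "K \<subseteq> wspace b \<and> relatively_compact_in (norm_topology (wspace b) (wnorm b)) K"
      using relatively_compact_wspace[OF assms(1) b c K(1) _ _ cpt, of "max c 0"] by simp
  qed
  moreover have ?c if ?a
    using that by (intro sum_ratio_tendsto_0_of_compactness[OF assms(1) b]) blast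
  moreover have "?b \<longleftrightarrow> ?c"
    using katetov_le_of_sum_ratio[OF assms(1) b] sum_ratio_of_katetov_le[OF assms] by blast
  ultimately show ?thesis by blast
qed

end
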